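(* Let $X$ be a Dedekind complete Riesz space with weak order unit $e$ and conditional expectation operator $T$ with $Te=e$. Let $(T_{n})_{n\ge1}$ be a filtration adapted with $T$ and let $(x_{n},T_{n})$ be a martingale in $X$ satisfying $T\sup_n|x_{n+1}-x_{n}|\in X^{u}$. Define the band projection on $X^{u}$ $$Q=\sup\{P:\ P\text{ a band projection such that }(Px_{n})\text{ is order convergent in }X^{u}\}.$$ Then $I-Q=P_{(\sup_n x_{n})^{\infty}}$.
   Context: A conditional expectation operator on $X$ is a strictly positive, order continuous linear projection $T$ with $Te=e$ whose range is a Dedekind complete Riesz subspace. A filtration adapted with $T$ is a sequence $(T_n)$ of conditional expectations with $T_nT_m=T_mT_n=T_{\min(n,m)}$ and $T_nT=TT_n=T$ for all $n,m$. A martingale is a sequence $(x_n)$ with $x_n\in R(T_n)$ and $T_ix_j=x_i$ for $i\le j$. $X^u$ is the universal completion of $X$. The sup-completion $X^{s}$ of $X$ is the lattice-ordered cone of classes of nonempty upward directed subsets of $X$ (with $A\sim B$ iff $\sup_{a\in A}(x\wedge a)=\sup_{b\in B}(x\wedge b)$ for all $x\in X$), containing $X$ and $X^u_+$, in which every nonempty set has a supremum; $T$ extends uniquely to an increasing map on $X^s_+$ preserving suprema of increasing nets, and $T\sup_n|x_{n+1}-x_n|$ is understood via this extension (with $\sup$ taken in $X^{s}$). Every $y\in X^{s}_{+}$ can be written uniquely as $y=\infty_{B}+u$ with $B$ a band of $X$, $\infty_B$ the supremum of $B$ in $X^{s}$, and $u\in X^u$, $u\perp B$; $y^{\infty}:=\infty_B$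 and $P_{y^\infty}$ is the band projection onto $B$. For $y\in X^s$ not necessarily positive, $y^\infty:=(y\vee 0)^\infty$. *)

theory Defs
  imports Complex_Main
begin

text \<open>Ambient space: the universal completion X^u, modelled as a type 'u that is a
Dedekind complete (conditionally complete) Riesz space which is laterally complete.
X is a subset of it which is an order dense Riesz subspace.\<close>

definition rabs :: "'u::{ordered_real_vector,lattice} \<Rightarrow> 'u" where
  "rabs x = sup x (- x)"

definition disj :: "'u::{ordered_real_vector,lattice} \<Rightarrow> 'u \<Rightarrow> bool" where
  "disj x y \<longleftrightarrow> inf (rabs x) (rabs y) = 0"

definition laterally_complete :: "'u::{ordered_real_vector,conditionally_complete_lattice} itself \<Rightarrow> bool" where
  "laterally_complete _ \<longleftrightarrow>
     (\<forall>D::'u set. (\<forall>d\<in>D. 0 \<le> d) \<and> (\<forall>a\<in>D. \<forall>b\<in>D. a \<noteq> b \<longrightarrow> disj a b) \<longrightarrow> bdd_above D)"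

definition riesz_subspace :: "'u::{ordered_real_vector,lattice} set \<Rightarrow> bool" where
  "riesz_subspace X \<longleftrightarrow> 0 \<in> X \<and> (\<forall>x\<in>X. \<forall>y\<in>X. x + y \<in> X \<and> sup x y \<in> X)
      \<and> (\<forall>c. \<forall>x\<in>X. c *\<^sub>R x \<in> X)"

definition order_dense :: "'u::{ordered_real_vector,lattice} set \<Rightarrow> bool" where
  "order_dense X \<longleftrightarrow> (\<forall>u. 0 < u \<longrightarrow> (\<exists>x\<in>X. 0 < x \<and> x \<le> u))"

definition is_lub_in :: "'u::order set \<Rightarrow> 'u set \<Rightarrow> 'u \<Rightarrow> bool" where
  "is_lub_in X A s \<longleftrightarrow> s \<in> X \<and> (\<forall>a\<in>A. a \<le> s) \<and> (\<forall>b\<in>X. (\<forall>a\<in>A. a \<le> b) \<longrightarrow> s \<le> b)"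

definition is_glb_in :: "'u::order set \<Rightarrow> 'u set \<Rightarrow> 'u \<Rightarrow> bool" where
  "is_glb_in X A s \<longleftrightarrow> s \<in> X \<and> (\<forall>a\<in>A. s \<le> a) \<and> (\<forall>b\<in>X. (\<forall>a\<in>A. b \<le> a) \<longrightarrow> b \<le> s)"

definition dedekind_complete_in :: "'u::order set \<Rightarrow> bool" where
  "dedekind_complete_in X \<longleftrightarrow>
     (\<forall>A. A \<subseteq> X \<and> A \<noteq> {} \<and> (\<exists>b\<in>X. \<forall>a\<in>A. a \<le> b) \<longrightarrow> (\<exists>s. is_lub_in X A s))"

definition weak_order_unit :: "'u::{ordered_real_vector,lattice} set \<Rightarrow> 'u \<Rightarrow> bool" where
  "weak_order_unit X e \<longleftrightarrow> e \<in> X \<and> 0 \<le> e \<and> (\<forall>x\<in>X. disj x e \<longrightarrow> x = 0)"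

definition down_directed :: "'u::order set \<Rightarrow> bool" where
  "down_directed D \<longleftrightarrow> (\<forall>a\<in>D. \<forall>b\<in>D. \<exists>c\<in>D. c \<le> a \<and> c \<le> b)"

text \<open>Conditional expectation operator on X (T is only relevant on X).
Order continuity (for a positive operator on a Dedekind complete space):
downward directed sets with infimum 0 are mapped to sets with infimum 0.\<close>
definition cond_exp :: "'u::{ordered_real_vector,lattice} set \<Rightarrow> 'u \<Rightarrow> ('u \<Rightarrow> 'u) \<Rightarrow> bool" where
  "cond_exp X e T \<longleftrightarrow>
     (\<forall>x\<in>X. T x \<in> X)
   \<and> (\<forall>x\<in>X. \<forall>y\<in>X. T (x + y) = T x + T y)
   \<and> (\<forall>c. \<forall>x\<in>X. T (c *\<^sub>R x) = c *\<^sub>R T x)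
   \<and> (\<forall>x\<in>X. 0 \<le> x \<longrightarrow> 0 \<le> T x)
   \<and> (\<forall>x\<in>X. T (rabs x) = 0 \<longrightarrow> x = 0)
   \<and> (\<forall>D. D \<subseteq> X \<and> D \<noteq> {} \<and> down_directed D \<and> is_glb_in X D 0 \<longrightarrow> is_glb_in X (T ` D) 0)
   \<and> (\<forall>x\<in>X. T (T x) = T x)
   \<and> T e = e
   \<and> riesz_subspace (T ` X) \<and> dedekind_complete_in (T ` X)"

definition filtration :: "'u::{ordered_real_vector,lattice} set \<Rightarrow> 'u \<Rightarrow> ('u \<Rightarrow> 'u) \<Rightarrow> (nat \<Rightarrow> 'u \<Rightarrow> 'u) \<Rightarrow> bool" where
  "filtration X e T Tn \<longleftrightarrow>
     (\<forall>n. cond_exp X e (Tn n))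
   \<and> (\<forall>n m. \<forall>x\<in>X. Tn n (Tn m x) = Tn (min n m) x \<and> Tn m (Tn n x) = Tn (min n m) x)
   \<and> (\<forall>n. \<forall>x\<in>X. Tn n (T x) = T x \<and> T (Tn n x) = T x)"

definition martingale :: "'u set \<Rightarrow> (nat \<Rightarrow> 'u \<Rightarrow> 'u) \<Rightarrow> (nat \<Rightarrow> 'u) \<Rightarrow> bool" where
  "martingale X Tn x \<longleftrightarrow> (\<forall>n. x n \<in> Tn n ` X) \<and> (\<forall>i j. i \<le> j \<longrightarrow> Tn i (x j) = x i)"

fun pmax :: "(nat \<Rightarrow> 'u::lattice) \<Rightarrow> nat \<Rightarrow> 'u" where
  "pmax f 0 = f 0"
| "pmax f (Suc n) = sup (pmax f n) (f (Suc n))"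

text \<open>Sup-completion X^s: classes of nonempty upward directed subsets A of X, with
A ~ C iff sup_{a in A}(x inf a) = sup_{c in C}(x inf c) (suprema in X) for all x in X.\<close>
definition sx_eq :: "'u::{ordered_real_vector,lattice} set \<Rightarrow> 'u set \<Rightarrow> 'u set \<Rightarrow> bool" where
  "sx_eq X A C \<longleftrightarrow> (\<forall>x\<in>X. \<forall>s. is_lub_in X {inf x a | a. a \<in> A} s \<longleftrightarrow> is_lub_in X {inf x c | c. c \<in> C} s)"

text \<open>Embedding of u in (X^u)_+ into X^s: the class of {x in X. 0 <= x <= u}.\<close>
definition below_set :: "'u::{ordered_real_vector,lattice} set \<Rightarrow> 'u \<Rightarrow> 'u set" where
  "below_set X u = {x\<in>X. 0 \<le> x \<and> x \<le> u}"

text \<open>The class of A (upward directed in X_+) lies in X^u.\<close>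
definition sx_in_Xu :: "'u::{ordered_real_vector,lattice} set \<Rightarrow> 'u set \<Rightarrow> bool" where
  "sx_in_Xu X A \<longleftrightarrow> (\<exists>u. 0 \<le> u \<and> sx_eq X A (below_set X u))"

definition band_in :: "'u::{ordered_real_vector,lattice} set \<Rightarrow> 'u set \<Rightarrow> bool" where
  "band_in X B \<longleftrightarrow> B \<subseteq> X \<and> riesz_subspace B
     \<and> (\<forall>y\<in>X. \<forall>b\<in>B. rabs y \<le> rabs b \<longrightarrow> y \<in> B)
     \<and> (\<forall>D s. D \<subseteq> B \<and> is_lub_in X D s \<longrightarrow> s \<in> B)"

definition msum :: "'u::plus set \<Rightarrow> 'u set \<Rightarrow> 'u set" where
  "msum A C = {a + c | a c. a \<in> A \<and> c \<in> C}"

text \<open>For the class y of A (a positive element of X^s), y = \<infinity>_B + u with B a band of X,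
u in X^u, u disjoint from B; y^\<infinity> = \<infinity>_B. We return the band B.\<close>
definition inf_band :: "'u::{ordered_real_vector,lattice} set \<Rightarrow> 'u set \<Rightarrow> 'u set" where
  "inf_band X A = (THE B. band_in X B \<and>
      (\<exists>u. 0 \<le> u \<and> (\<forall>b\<in>B. disj u b) \<and> sx_eq X A (msum B (below_set X u))))"

definition is_bp :: "('u::{ordered_real_vector,lattice} \<Rightarrow> 'u) \<Rightarrow> bool" where
  "is_bp P \<longleftrightarrow> (\<forall>x y. P (x + y) = P x + P y) \<and> (\<forall>c x. P (c *\<^sub>R x) = c *\<^sub>R P x)
      \<and> (\<forall>x. P (P x) = P x) \<and> (\<forall>u. 0 \<le> u \<longrightarrow> 0 \<le> P u \<and> P u \<le> u)"

definition bp_le :: "('u::{ordered_real_vector,lattice} \<Rightarrow> 'u) \<Rightarrow> ('u \<Rightarrow> 'u) \<Rightarrow> bool" where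
  "bp_le P R \<longleftrightarrow> (\<forall>u. 0 \<le> u \<longrightarrow> P u \<le> R u)"

definition bp_Sup :: "('u::{ordered_real_vector,lattice} \<Rightarrow> 'u) set \<Rightarrow> ('u \<Rightarrow> 'u)" where
  "bp_Sup F = (THE Q. is_bp Q \<and> (\<forall>P\<in>F. bp_le P Q)
       \<and> (\<forall>R. is_bp R \<and> (\<forall>P\<in>F. bp_le P R) \<longrightarrow> bp_le Q R))"

definition bp_onto :: "'u::{ordered_real_vector,lattice} set \<Rightarrow> ('u \<Rightarrow> 'u)" where
  "bp_onto B = (THE P. is_bp P \<and> (\<forall>b\<in>B. P b = b) \<and> (\<forall>u. (\<forall>b\<in>B. disj u b) \<longrightarrow> P u = 0))"

definition ord_conv :: "(nat \<Rightarrow> 'u::{ordered_real_vector,lattice}) \<Rightarrow> 'u \<Rightarrow> bool" where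
  "ord_conv f v \<longleftrightarrow> (\<exists>p. (\<forall>n. p (Suc n) \<le> p n) \<and> (\<forall>w. (\<forall>n. w \<le> p n) \<longrightarrow> w \<le> 0)
       \<and> (\<forall>n. rabs (f n - v) \<le> p n))"

end

theory Submission
  imports Defs
begin

text \<open>
  Let \<open>E\<^sub>K\<close> be the event \<open>sup x > K\<close> and let \<open>x\<close> be stopped when it first exceeds \<open>K e\<close>. The overshoot is at
  most one jump, so the positive parts of the stopped martingale have order bounded images under \<open>T\<close>.
  Selling short above \<open>b\<close> and covering below \<open>a\<close> then bounds \<open>T\<close> of the number of downcrossings of
  \<open>[a, b]\<close>; everything takes place at finite times, so \<open>T\<close> need not be extended beyond \<open>X\<close>. Hence
  the stopped martingale is bounded below and does not oscillate, and \<open>x\<close> converges on the complement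
  of \<open>E\<^sub>K\<close>, up to a decomposition of it into countably many bands. Conversely \<open>x\<close> is order bounded on
  any band on which it converges, so such a band is disjoint from the infimum of the \<open>E\<^sub>K\<close>, which is
  the band where \<open>sup x = \<infinity>\<close>. Events are represented by band projections, intersections by compositions.
\<close>

text \<open>There are no points, so almost everywhere statements become statements about bands that
  exhaust the space (\<open>no_oscillation\<close>). Downcrossings are counted because only an upper
  bound is at hand: the open loss of a short position is \<open>y n - b e\<close>, controlled by the
  dominating \<open>g n\<close>, while that of a long position is governed by the negative part.
  Starting short makes the first passage below \<open>a\<close> count as a crossing, so one
  inequality yields both a maximal inequality (lower boundedness, letting \<open>a\<close> decrease)
  and finiteness of the oscillations. Order convergence needs order bounds, and the stopped
  martingale is bounded below only locally; cutting by the events of falling below \<open>-j\<close>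
  suffices because \<open>Q\<close> is a supremum. Suprema in X^u may leave the domain of
  \<open>T\<close>, hence the truncations at \<open>e\<close> and the bounds
  \<open>T (f n) \<le> y\<close> with \<open>y\<close> in X^u.\<close>

section \<open>Riesz space identities\<close>

lemma add_sup:
  fixes a b c :: "'u::{ordered_real_vector,lattice}"
  shows "a + sup b c = sup (a + b) (a + c)"
proof (rule antisym)
  have "sup b c \<le> - a + sup (a + b) (a + c)"
    by (rule sup_least) (metis add_left_mono minus_add_cancel sup_ge1 sup_ge2)+
  then show "a + sup b c \<le> sup (a + b) (a + c)"
    by (metis add_left_mono add_minus_cancel)
qed (simp add: add_left_mono)

lemma neg_sup:
  fixes a b :: "'u::{ordered_real_vector,lattice}"
  shows "- sup a b = inf (- a) (- b)"
proof (rule antisym)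
  have "sup a b \<le> - inf (- a) (- b)"
    by (rule sup_least; subst le_minus_iff; simp)
  then show "inf (- a) (- b) \<le> - sup a b"
    by (simp add: le_minus_iff)
qed simp

lemma neg_inf:
  fixes a b :: "'u::{ordered_real_vector,lattice}"
  shows "- inf a b = sup (- a) (- b)"
proof -
  have "- sup (- a) (- b) = inf a b" using neg_sup[of "- a" "- b"] by (simp only: minus_minus)
  then show ?thesis by (metis minus_minus)
qed

lemma add_inf:
  fixes a b c :: "'u::{ordered_real_vector,lattice}"
  shows "a + inf b c = inf (a + b) (a + c)"
proof -
  have "- (a + inf b c) = - inf (a + b) (a + c)"
    by (simp add: neg_inf add_sup)
  then show ?thesis by (metis neg_equal_iff_equal)
qed

lemma sup_plus_inf:
  fixes a b :: "'u::{ordered_real_vector,lattice}"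
  shows "sup a b + inf a b = a + b"
proof -
  have "a + b + - sup a b = inf b a"
    unfolding neg_sup by (simp add: add_inf)
  then show ?thesis by (metis add.commute diff_add_cancel inf.commute uminus_add_conv_diff)
qed

lemma scaleR_sup:
  fixes a b :: "'u::{ordered_real_vector,lattice}"
  assumes "0 \<le> r"
  shows "r *\<^sub>R sup a b = sup (r *\<^sub>R a) (r *\<^sub>R b)"
proof (cases "r = 0")
  case False
  with assms have r: "0 < r" by simp
  show ?thesis
  proof (rule antisym)
    have "sup a b \<le> (1 / r) *\<^sub>R sup (r *\<^sub>R a) (r *\<^sub>R b)"
    proof (rule sup_least)
      have "(1 / r) *\<^sub>R (r *\<^sub>R a) \<le> (1 / r) *\<^sub>R sup (r *\<^sub>R a) (r *\<^sub>R b)"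
        using r by (intro scaleR_left_mono) auto
      then show "a \<le> (1 / r) *\<^sub>R sup (r *\<^sub>R a) (r *\<^sub>R b)" using r by simp
      have "(1 / r) *\<^sub>R (r *\<^sub>R b) \<le> (1 / r) *\<^sub>R sup (r *\<^sub>R a) (r *\<^sub>R b)"
        using r by (intro scaleR_left_mono) auto
      then show "b \<le> (1 / r) *\<^sub>R sup (r *\<^sub>R a) (r *\<^sub>R b)" using r by simp
    qed
    from scaleR_left_mono[OF this assms] show "r *\<^sub>R sup a b \<le> sup (r *\<^sub>R a) (r *\<^sub>R b)"
      using r by simp
  qed (simp add: scaleR_left_mono assms)
qed simp

lemma scaleR_inf:
  fixes a b :: "'u::{ordered_real_vector,lattice}"
  assumes "0 \<le> r"
  shows "r *\<^sub>R inf a b = inf (r *\<^sub>R a) (r *\<^sub>R b)"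
proof -
  have "- (r *\<^sub>R inf a b) = - inf (r *\<^sub>R a) (r *\<^sub>R b)"
    using scaleR_sup[OF assms, of "- a" "- b"] by (simp add: neg_inf[symmetric])
  then show ?thesis by (metis neg_equal_iff_equal)
qed

lemma pos_part_diff:
  fixes x :: "'u::{ordered_real_vector,lattice}"
  shows "sup x 0 - sup (- x) 0 = x"
proof -
  have "- sup (- x) 0 = inf x 0" using neg_sup[of "- x" 0] by (simp only: minus_minus minus_zero)
  then show ?thesis using sup_plus_inf[of x 0] by (simp only: diff_conv_add_uminus add_0_right)
qed

lemma pos_neg_disjoint:
  fixes x :: "'u::{ordered_real_vector,lattice}"
  shows "inf (sup x 0) (sup (- x) 0) = 0"
proof -
  have "inf (sup x 0) (sup (- x) 0) = inf (sup x 0 + 0) (sup x 0 + - x)"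
    using pos_part_diff[of x] by (simp add: algebra_simps)
  also have "\<dots> = sup x 0 + inf 0 (- x)" by (simp only: add_inf)
  also have "\<dots> = sup x 0 + - sup 0 x" by (simp only: neg_sup minus_zero)
  finally show ?thesis by (simp add: sup.commute)
qed

lemma rabs_pos_neg:
  fixes x :: "'u::{ordered_real_vector,lattice}"
  shows "rabs x = sup x 0 + sup (- x) 0"
proof -
  have "x + rabs x = sup (2 *\<^sub>R x) (2 *\<^sub>R 0)"
    unfolding rabs_def add_sup by (simp add: scaleR_2)
  also have "\<dots> = 2 *\<^sub>R sup x 0" by (simp only: scaleR_sup zero_le_numeral)
  finally have "x + rabs x = sup x 0 + sup x 0" by (simp add: scaleR_2)
  then have "rabs x = sup x 0 + sup x 0 - x" by (simp add: eq_diff_eq add.commute)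
  also have "\<dots> = sup x 0 + sup x 0 - (sup x 0 - sup (- x) 0)" by (simp only: pos_part_diff)
  finally show ?thesis by simp
qed

lemma rabs_nonneg: "0 \<le> rabs (x::'u::{ordered_real_vector,lattice})"
  unfolding rabs_pos_neg by simp

lemma rabs_eq: "0 \<le> x \<Longrightarrow> rabs (x::'u::{ordered_real_vector,lattice}) = x"
  unfolding rabs_def by (meson neg_le_0_iff_le order.trans sup_absorb1)

lemma rabs_ge: "x \<le> rabs (x::'u::{ordered_real_vector,lattice})" "- x \<le> rabs x"
  unfolding rabs_def by auto

lemma rabs_leI: "x \<le> y \<Longrightarrow> - x \<le> y \<Longrightarrow> rabs x \<le> (y::'u::{ordered_real_vector,lattice})"
  unfolding rabs_def by auto

lemma inf_add_le:
  fixes a b c :: "'u::{ordered_real_vector,lattice}"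
  assumes "0 \<le> a" "0 \<le> b" "0 \<le> c"
  shows "inf a (b + c) \<le> inf a b + inf a c"
proof -
  have "a \<le> inf a b + a" using assms by simp
  moreover have "inf a (b + c) \<le> c + inf a b"
    unfolding add_inf
  proof (rule le_infI)
    show "inf a (b + c) \<le> c + a" by (rule le_infI1) (simp add: assms)
    show "inf a (b + c) \<le> c + b" by (simp add: add.commute)
  qed
  ultimately have "inf a (b + c) \<le> inf (inf a b + a) (inf a b + c)"
    by (simp add: le_infI1 add.commute)
  then show ?thesis by (simp only: add_inf)
qed

lemma inf_add_pos_le:
  fixes a b c :: "'u::{ordered_real_vector,lattice}"
  assumes "0 \<le> a"
  shows "inf (a + b) c \<le> a + inf b c"
proof -
  have "inf (a + b) c \<le> inf (a + b) (a + c)"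
    using assms by (intro inf_mono) simp_all
  then show ?thesis by (simp only: add_inf)
qed

section \<open>Suprema in the ambient space\<close>

abbreviation is_lub :: "'u::order set \<Rightarrow> 'u \<Rightarrow> bool" where
  "is_lub \<equiv> is_lub_in UNIV"

lemma is_lubI: "(\<And>a. a \<in> A \<Longrightarrow> a \<le> s) \<Longrightarrow> (\<And>y. (\<And>a. a \<in> A \<Longrightarrow> a \<le> y) \<Longrightarrow> s \<le> y) \<Longrightarrow> is_lub A s"
  unfolding is_lub_in_def by auto

lemma is_lub_upper: "is_lub A s \<Longrightarrow> a \<in> A \<Longrightarrow> a \<le> s"
  unfolding is_lub_in_def by auto

lemma is_lub_least: "is_lub A s \<Longrightarrow> (\<And>a. a \<in> A \<Longrightarrow> a \<le> y) \<Longrightarrow> s \<le> y"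
  unfolding is_lub_in_def by auto

lemma is_lub_unique: "is_lub A s \<Longrightarrow> is_lub A t \<Longrightarrow> s = t"
  by (meson antisym is_lub_least is_lub_upper)

lemma is_lub_cSup:
  fixes A :: "'u::conditionally_complete_lattice set"
  assumes "A \<noteq> {}" and y: "\<And>a. a \<in> A \<Longrightarrow> a \<le> y"
  shows "is_lub A (Sup A)"
proof (rule is_lubI)
  show "a \<le> Sup A" if "a \<in> A" for a
    by (rule cSup_upper[OF that bdd_aboveI]) (rule y)
  show "Sup A \<le> z" if "\<And>a. a \<in> A \<Longrightarrow> a \<le> z" for z
    using cSup_least[OF assms(1)] that by blast
qed

text \<open>Infinite distributivity, from \<open>f n = inf x (f n) + (sup x (f n) - x)\<close>: the
  second summand is at most \<open>sup x s - x\<close>.\<close>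

lemma is_lub_inf:
  fixes s :: "'u::{ordered_real_vector,lattice}"
  assumes "is_lub (range f) s"
  shows "is_lub (range (\<lambda>n. inf x (f n))) (inf x s)"
proof (rule is_lubI)
  show "\<And>a. a \<in> range (\<lambda>n. inf x (f n)) \<Longrightarrow> a \<le> inf x s"
    using is_lub_upper[OF assms] by (auto intro: le_infI2)
next
  fix y assume y: "\<And>a. a \<in> range (\<lambda>n. inf x (f n)) \<Longrightarrow> a \<le> y"
  have "s \<le> y + (sup x s - x)"
  proof (rule is_lub_least[OF assms], clarify)
    fix n
    have "f n = inf x (f n) + (sup x (f n) - x)"
      using sup_plus_inf[of x "f n"] by (simp add: algebra_simps)
    also have "\<dots> \<le> y + (sup x s - x)"
      using y is_lub_upper[OF assms, of "f n"]
      by (intro add_mono diff_mono) (auto intro: le_supI2)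
    finally show "f n \<le> y + (sup x s - x)" .
  qed
  then have "s + x - sup x s \<le> y" by (simp add: algebra_simps)
  moreover have "inf x s = s + x - sup x s" using sup_plus_inf[of x s] by (simp add: algebra_simps)
  ultimately show "inf x s \<le> y" by simp
qed

text \<open>Dedekind completeness implies the Archimedean property: shifting the multiples by one
  shows that their supremum \<open>s\<close> satisfies \<open>s \<le> s - b\<close>.\<close>

lemma archimedean_le_0:
  fixes b u :: "'u::{ordered_real_vector,conditionally_complete_lattice}"
  assumes "\<And>n::nat. real n *\<^sub>R b \<le> u"
  shows "b \<le> 0"
proof -
  let ?A = "range (\<lambda>n::nat. real n *\<^sub>R b)"
  have l: "is_lub ?A (Sup ?A)"
    by (rule is_lub_cSup) (use assms in auto)
  have "Sup ?A \<le> Sup ?A - b"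
  proof (rule is_lub_least[OF l], clarify)
    fix n :: nat
    have "real (Suc n) *\<^sub>R b \<le> Sup ?A" by (rule is_lub_upper[OF l]) blast
    then show "real n *\<^sub>R b \<le> Sup ?A - b" by (simp add: algebra_simps)
  qed
  then show ?thesis by simp
qed

section \<open>Band projections\<close>

context
  fixes P :: "'u::{ordered_real_vector,lattice} \<Rightarrow> 'u"
  assumes P: "is_bp P"
begin

lemma bp_add: "P (x + y) = P x + P y"
  and bp_scaleR: "P (c *\<^sub>R x) = c *\<^sub>R P x"
  and bp_idem: "P (P x) = P x"
  and bp_nonneg: "0 \<le> u \<Longrightarrow> 0 \<le> P u"
  and bp_below: "0 \<le> u \<Longrightarrow> P u \<le> u"
proof -
  show "P (x + y) = P x + P y" "P (c *\<^sub>R x) = c *\<^sub>R P x" "P (P x) = P x"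
    using P by (simp_all only: is_bp_def)
  show "0 \<le> u \<Longrightarrow> 0 \<le> P u" "0 \<le> u \<Longrightarrow> P u \<le> u"
    using P by (simp_all only: is_bp_def)
qed

lemma bp_zero: "P 0 = 0"
  using bp_scaleR[of 0 0] by simp

lemma bp_uminus: "P (- x) = - P x"
  using bp_scaleR[of "-1" x] by simp

lemma bp_diff: "P (x - y) = P x - P y"
  using bp_add[of x "- y"] by (simp add: bp_uminus)

lemma bp_mono: "x \<le> y \<Longrightarrow> P x \<le> P y"
  using bp_nonneg[of "y - x"] by (simp add: bp_diff)

lemma bp_compl_mono: "x \<le> y \<Longrightarrow> x - P x \<le> y - P y"
  using bp_below[of "y - x"] by (simp add: bp_diff algebra_simps)

lemma bp_compl: "is_bp (\<lambda>x. x - P x)"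
  unfolding is_bp_def using bp_nonneg bp_below
  by (simp add: bp_add bp_diff bp_scaleR bp_idem scaleR_diff_right)

lemma bp_split_le: "P x \<le> P y \<Longrightarrow> x - P x \<le> y - P y \<Longrightarrow> x \<le> y"
  using add_mono[of "P x" "P y" "x - P x" "y - P y"] by simp

lemma bp_inf: "P (inf x y) = inf (P x) (P y)"
proof (rule antisym)
  show "P (inf x y) \<le> inf (P x) (P y)" by (simp add: bp_mono)
next
  let ?l = "inf (P x) (P y)"
  \<comment> \<open>Replacing the \<open>P\<close>-component of \<open>inf x y\<close> by
    \<open>P ?l\<close> still gives a lower bound of \<open>x\<close> and \<open>y\<close>, so
    \<open>P ?l\<close> cannot exceed that component.\<close>
  let ?t = "P ?l + (inf x y - P (inf x y))"
  have "P ?l \<le> P x" "P ?l \<le> P y"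
    by (metis bp_idem bp_mono inf_le1 inf_le2)+
  then have "?t \<le> inf x y"
    using add_mono[of "P ?l" "P x" "inf x y - P (inf x y)" "x - P x"]
      add_mono[of "P ?l" "P y" "inf x y - P (inf x y)" "y - P y"]
    by (simp add: bp_compl_mono)
  then have "P ?t \<le> P (inf x y)" by (rule bp_mono)
  then have 1: "P ?l \<le> P (inf x y)" by (simp add: bp_add bp_diff bp_idem)
  have "?l - P ?l \<le> P x - P (P x)" by (rule bp_compl_mono) simp
  then have "?l \<le> P ?l" by (simp add: bp_idem)
  with 1 show "?l \<le> P (inf x y)" by simp
qed

lemma bp_sup: "P (sup x y) = sup (P x) (P y)"
proof -
  have "P (- sup x y) = - sup (P x) (P y)"
    by (simp only: neg_sup bp_inf bp_uminus)
  then show ?thesis by (simp add: bp_uminus)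
qed

lemma bp_rabs: "P (rabs x) = rabs (P x)"
  unfolding rabs_def by (simp add: bp_sup bp_uminus)

lemma bp_rabs_le: "rabs (P x) \<le> rabs x"
  unfolding bp_rabs[symmetric] by (rule bp_below) (rule rabs_nonneg)

lemma bp_fixed_below: "P y = y \<Longrightarrow> 0 \<le> x \<Longrightarrow> x \<le> y \<Longrightarrow> P x = x"
  using bp_compl_mono[of x y] bp_below[of x] by (simp add: antisym)

lemma bp_null_below: "P y = 0 \<Longrightarrow> 0 \<le> x \<Longrightarrow> x \<le> y \<Longrightarrow> P x = 0"
  using bp_mono[of x y] bp_nonneg[of x] by (metis order.antisym)

lemma bp_disjoint: "0 \<le> x \<Longrightarrow> 0 \<le> y \<Longrightarrow> P x = x \<Longrightarrow> P y = 0 \<Longrightarrow> inf x y = 0"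
  by (metis bp_fixed_below bp_null_below inf_le1 inf_le2 le_infI)

text \<open>Order continuity: a bound for the projected sequence, completed by the complementary
  component of \<open>s\<close>, bounds the sequence itself.\<close>

lemma bp_lub:
  assumes "is_lub (range f) s"
  shows "is_lub (range (\<lambda>n. P (f n))) (P s)"
proof (rule is_lubI)
  show "\<And>a. a \<in> range (\<lambda>n. P (f n)) \<Longrightarrow> a \<le> P s"
    using is_lub_upper[OF assms] by (auto intro: bp_mono)
next
  fix y assume y: "\<And>a. a \<in> range (\<lambda>n. P (f n)) \<Longrightarrow> a \<le> y"
  have Py: "P (f n) \<le> P y" for n
    using bp_mono[of "P (f n)" y] y by (simp add: bp_idem)
  have "s \<le> P y + (s - P s)"
  proof (rule is_lub_least[OF assms], clarify)
    fix n
    have "f n = P (f n) + (f n - P (f n))" by simp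
    also have "\<dots> \<le> P y + (s - P s)"
      using Py is_lub_upper[OF assms] by (intro add_mono bp_compl_mono) auto
    finally show "f n \<le> P y + (s - P s)" .
  qed
  then have 1: "P s \<le> P y" by (simp add: algebra_simps)
  \<comment> \<open>Any index does: the range is nonempty, and the complementary component of
    \<open>P (f n)\<close> is zero, so that of \<open>y\<close> is nonnegative.\<close>
  have "P (f undefined) - P (P (f undefined)) \<le> y - P y" using y by (intro bp_compl_mono) auto
  then have "P y \<le> y" by (simp add: bp_idem)
  with 1 show "P s \<le> y" by simp
qed

end

lemma is_bp_linearI:
  fixes P R :: "'u::{ordered_real_vector,lattice} \<Rightarrow> 'u"
  assumes "is_bp P" "is_bp R"
    and "\<And>u. 0 \<le> u \<Longrightarrow> P u = R u"
  shows "P x = R x"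
proof -
  have "P (sup x 0 - sup (- x) 0) = R (sup x 0 - sup (- x) 0)"
    using assms by (simp add: bp_diff)
  then show ?thesis by (simp only: pos_part_diff)
qed

text \<open>For \<open>u \<ge> 0\<close>, \<open>R\<close> maps \<open>P u\<close> below itself,
  hence into the band of \<open>P\<close>, and \<open>u - P u\<close> below itself, hence into the
  null band of \<open>P\<close>.\<close>

lemma bp_commute:
  fixes P R :: "'u::{ordered_real_vector,lattice} \<Rightarrow> 'u"
  assumes P: "is_bp P" and R: "is_bp R"
  shows "P (R x) = R (P x)"
proof -
  have *: "P (R u) = R (P u)" if u: "0 \<le> u" for u
  proof -
    have "P (R (P u)) = R (P u)"
      by (rule bp_fixed_below[OF P, of "P u"])
        (use u in \<open>auto simp: bp_idem[OF P] bp_nonneg[OF P] bp_nonneg[OF R] bp_below[OF R]\<close>)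
    moreover have "P (R (u - P u)) = 0"
      by (rule bp_null_below[OF P, of "u - P u"])
        (use u in \<open>auto simp: bp_idem[OF P] bp_diff[OF P] bp_below[OF P] bp_nonneg[OF R] bp_below[OF R]\<close>)
    ultimately show ?thesis by (simp add: bp_diff[OF R] bp_diff[OF P])
  qed
  have "P (R (sup x 0 - sup (- x) 0)) = R (P (sup x 0 - sup (- x) 0))"
    by (simp add: bp_diff[OF P] bp_diff[OF R] *)
  then show ?thesis by (simp only: pos_part_diff)
qed

lemma bp_comp:
  fixes P R :: "'u::{ordered_real_vector,lattice} \<Rightarrow> 'u"
  assumes P: "is_bp P" and R: "is_bp R"
  shows "is_bp (\<lambda>x. P (R x))"
proof -
  have "P (R u) \<le> u" if "0 \<le> u" for u
    using that bp_below[OF P, of "R u"] bp_below[OF R, of u] bp_nonneg[OF R, of u]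
    by (meson order.trans)
  moreover have "P (R (P (R x))) = P (R x)" for x
    by (metis bp_commute[OF P R] bp_idem[OF P] bp_idem[OF R])
  ultimately show ?thesis
    unfolding is_bp_def
    by (simp add: bp_add[OF P] bp_add[OF R] bp_scaleR[OF P] bp_scaleR[OF R] bp_nonneg[OF P] bp_nonneg[OF R])
qed

lemma bp_id: "is_bp (\<lambda>x::'u::{ordered_real_vector,lattice}. x)"
  unfolding is_bp_def by simp

section \<open>Projections onto principal bands\<close>

definition pos_proj :: "'u::{ordered_real_vector,conditionally_complete_lattice} \<Rightarrow> 'u \<Rightarrow> 'u" where
  "pos_proj v u = Sup (range (\<lambda>n::nat. inf u (real n *\<^sub>R v)))"

text \<open>For \<open>v \<ge> 0\<close>, the projection onto the band generated by \<open>v\<close>; junk otherwise.\<close>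
definition bproj :: "'u::{ordered_real_vector,conditionally_complete_lattice} \<Rightarrow> 'u \<Rightarrow> 'u" where
  "bproj v x = pos_proj v (sup x 0) - pos_proj v (sup (- x) 0)"

lemma pos_proj_lub: "is_lub (range (\<lambda>n::nat. inf u (real n *\<^sub>R v))) (pos_proj v u)"
  unfolding pos_proj_def by (rule is_lub_cSup[of _ u]) auto

lemma pos_proj_ge: "inf u (real n *\<^sub>R v) \<le> pos_proj v u"
  by (rule is_lub_upper[OF pos_proj_lub]) blast

lemma pos_proj_le: "(\<And>n::nat. inf u (real n *\<^sub>R v) \<le> y) \<Longrightarrow> pos_proj v u \<le> y"
  by (rule is_lub_least[OF pos_proj_lub]) auto

context
  fixes v :: "'u::{ordered_real_vector,conditionally_complete_lattice}"
  assumes v: "0 \<le> v"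
begin

lemma pos_proj_add:
  assumes "0 \<le> a" "0 \<le> b"
  shows "pos_proj v (a + b) = pos_proj v a + pos_proj v b"
proof (rule antisym)
  show "pos_proj v (a + b) \<le> pos_proj v a + pos_proj v b"
  proof (rule pos_proj_le)
    fix n :: nat
    have "inf (real n *\<^sub>R v) (a + b) \<le> inf (real n *\<^sub>R v) a + inf (real n *\<^sub>R v) b"
      by (rule inf_add_le) (use assms v in \<open>auto simp: scaleR_nonneg_nonneg\<close>)
    also have "\<dots> \<le> pos_proj v a + pos_proj v b"
      using pos_proj_ge[of a n v] pos_proj_ge[of b n v] by (intro add_mono) (simp_all add: inf.commute)
    finally show "inf (a + b) (real n *\<^sub>R v) \<le> pos_proj v a + pos_proj v b" by (simp add: inf.commute)
  qed
next
  have *: "inf a (real n *\<^sub>R v) + inf b (real m *\<^sub>R v) \<le> pos_proj v (a + b)" for n m :: nat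
  proof -
    have "inf a (real n *\<^sub>R v) + inf b (real m *\<^sub>R v) \<le> inf (a + b) (real (n + m) *\<^sub>R v)"
      by (simp add: add_mono scaleR_add_left)
    also have "\<dots> \<le> pos_proj v (a + b)" by (rule pos_proj_ge)
    finally show ?thesis .
  qed
  have "pos_proj v a \<le> pos_proj v (a + b) - inf b (real m *\<^sub>R v)" for m
    by (rule pos_proj_le) (use * in \<open>simp add: algebra_simps\<close>)
  then have "pos_proj v b \<le> pos_proj v (a + b) - pos_proj v a"
    by (intro pos_proj_le) (simp add: algebra_simps)
  then show "pos_proj v a + pos_proj v b \<le> pos_proj v (a + b)" by (simp add: algebra_simps)
qed

lemma pos_proj_scaleR_ge:
  assumes "0 \<le> a" "0 < r"
  shows "pos_proj v (r *\<^sub>R a) \<le> r *\<^sub>R pos_proj v a"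
proof (rule pos_proj_le)
  fix n :: nat
  obtain m :: nat where m: "real n / r \<le> real m" using real_arch_simple by blast
  have "inf a ((real n / r) *\<^sub>R v) \<le> inf a (real m *\<^sub>R v)"
    using m v by (intro inf_mono) (auto simp: scaleR_right_mono)
  also have "\<dots> \<le> pos_proj v a" by (rule pos_proj_ge)
  finally have "r *\<^sub>R inf a ((real n / r) *\<^sub>R v) \<le> r *\<^sub>R pos_proj v a"
    using assms by (intro scaleR_left_mono) auto
  then show "inf (r *\<^sub>R a) (real n *\<^sub>R v) \<le> r *\<^sub>R pos_proj v a"
    using assms by (simp add: scaleR_inf)
qed

lemma pos_proj_scaleR:
  assumes a: "0 \<le> a" and "0 \<le> r"
  shows "pos_proj v (r *\<^sub>R a) = r *\<^sub>R pos_proj v a"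
proof (cases "r = 0")
  case True
  have "pos_proj v 0 = 0"
    by (rule is_lub_unique[OF pos_proj_lub], rule is_lubI) (use v in \<open>auto simp: scaleR_nonneg_nonneg inf_absorb1\<close>)
  then show ?thesis by (simp add: True)
next
  case False
  with assms have r: "0 < r" by simp
  have "pos_proj v ((1 / r) *\<^sub>R (r *\<^sub>R a)) \<le> (1 / r) *\<^sub>R pos_proj v (r *\<^sub>R a)"
    by (rule pos_proj_scaleR_ge) (use a r in \<open>auto simp: scaleR_nonneg_nonneg\<close>)
  then have "r *\<^sub>R pos_proj v a \<le> r *\<^sub>R ((1 / r) *\<^sub>R pos_proj v (r *\<^sub>R a))"
    using r by (intro scaleR_left_mono) auto
  then have "r *\<^sub>R pos_proj v a \<le> pos_proj v (r *\<^sub>R a)" using r by simp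
  then show ?thesis using pos_proj_scaleR_ge[OF a r] by simp
qed

lemma pos_proj_nonneg: "0 \<le> a \<Longrightarrow> 0 \<le> pos_proj v a"
  using pos_proj_ge[of a 0 v] by (simp add: inf_absorb2)

lemma pos_proj_below: "pos_proj v a \<le> a"
  by (rule pos_proj_le) simp

lemma pos_proj_idem: "pos_proj v (pos_proj v a) = pos_proj v a"
proof (rule antisym[OF pos_proj_below], rule pos_proj_le)
  fix n :: nat
  have "inf a (real n *\<^sub>R v) \<le> inf (pos_proj v a) (real n *\<^sub>R v)" by (simp add: pos_proj_ge)
  also have "\<dots> \<le> pos_proj v (pos_proj v a)" by (rule pos_proj_ge)
  finally show "inf a (real n *\<^sub>R v) \<le> pos_proj v (pos_proj v a)" .
qed

text \<open>By additivity of \<open>pos_proj\<close>, any difference of nonnegative elements may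
  replace the positive and negative parts; linearity of \<open>bproj\<close> rests on this.\<close>

lemma bproj_diff:
  assumes "0 \<le> a" "0 \<le> b"
  shows "bproj v (a - b) = pos_proj v a - pos_proj v b"
proof -
  have "sup (a - b) 0 + b = a + sup (- (a - b)) 0"
    using pos_part_diff[of "a - b"] by (simp add: algebra_simps)
  then have "pos_proj v (sup (a - b) 0) + pos_proj v b = pos_proj v a + pos_proj v (sup (- (a - b)) 0)"
    using assms pos_proj_add by (metis sup_ge2)
  then show ?thesis unfolding bproj_def by (simp add: algebra_simps)
qed

lemma bproj_pos: "0 \<le> a \<Longrightarrow> bproj v a = pos_proj v a"
  using bproj_diff[of a 0] pos_proj_scaleR[of 0 0] by simp

lemma bproj_lub: "0 \<le> u \<Longrightarrow> is_lub (range (\<lambda>n::nat. inf u (real n *\<^sub>R v))) (bproj v u)"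
  by (simp add: bproj_pos pos_proj_lub)

lemma is_bp_bproj: "is_bp (bproj v)"
  unfolding is_bp_def
proof (intro conjI allI impI)
  fix x y :: 'u
  have "x + y = (sup x 0 + sup y 0) - (sup (- x) 0 + sup (- y) 0)"
    using pos_part_diff[of x] pos_part_diff[of y] by (simp add: algebra_simps)
  then have "bproj v (x + y) = pos_proj v (sup x 0 + sup y 0) - pos_proj v (sup (- x) 0 + sup (- y) 0)"
    by (simp only: bproj_diff sup_ge2 add_nonneg_nonneg)
  also have "\<dots> = bproj v x + bproj v y" unfolding bproj_def by (simp add: pos_proj_add)
  finally show "bproj v (x + y) = bproj v x + bproj v y" .
next
  fix c :: real and x :: 'u
  show "bproj v (c *\<^sub>R x) = c *\<^sub>R bproj v x"
  proof (cases "0 \<le> c")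
    case True
    have "c *\<^sub>R x = c *\<^sub>R sup x 0 - c *\<^sub>R sup (- x) 0"
      by (metis pos_part_diff scaleR_diff_right)
    then have "bproj v (c *\<^sub>R x) = pos_proj v (c *\<^sub>R sup x 0) - pos_proj v (c *\<^sub>R sup (- x) 0)"
      using True by (simp add: bproj_diff scaleR_nonneg_nonneg)
    then show ?thesis using True unfolding bproj_def by (simp add: pos_proj_scaleR scaleR_diff_right)
  next
    case False
    have "c *\<^sub>R x = (- c) *\<^sub>R sup (- x) 0 - (- c) *\<^sub>R sup x 0"
      using arg_cong[OF pos_part_diff[of x], of "\<lambda>z. c *\<^sub>R z"] by (simp add: scaleR_diff_right)
    then have "bproj v (c *\<^sub>R x) = pos_proj v ((- c) *\<^sub>R sup (- x) 0) - pos_proj v ((- c) *\<^sub>R sup x 0)"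
      using False bproj_diff[of "(- c) *\<^sub>R sup (- x) 0" "(- c) *\<^sub>R sup x 0"] scaleR_nonneg_nonneg[of "- c"]
      by (metis linear neg_0_le_iff_le sup_ge2)
    also have "\<dots> = (- c) *\<^sub>R pos_proj v (sup (- x) 0) - (- c) *\<^sub>R pos_proj v (sup x 0)"
      using False by (simp only: pos_proj_scaleR sup_ge2 neg_0_le_iff_le linear)
    finally show ?thesis unfolding bproj_def by (simp add: scaleR_diff_right)
  qed
next
  fix x :: 'u
  have "bproj v (bproj v x) = pos_proj v (pos_proj v (sup x 0)) - pos_proj v (pos_proj v (sup (- x) 0))"
    by (subst (2) bproj_def) (simp add: bproj_diff pos_proj_nonneg)
  then show "bproj v (bproj v x) = bproj v x"
    unfolding pos_proj_idem by (simp add: bproj_def)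
next
  fix u :: 'u assume "0 \<le> u"
  then show "0 \<le> bproj v u" "bproj v u \<le> u"
    by (simp_all add: bproj_pos pos_proj_nonneg pos_proj_below)
qed

lemma bproj_self: "bproj v v = v"
  using pos_proj_ge[of v 1 v] bp_below[OF is_bp_bproj v] by (simp add: bproj_pos v antisym)

lemma bproj_disjoint:
  assumes u: "0 \<le> u" and uv: "inf u v = 0"
  shows "bproj v u = 0"
proof -
  have *: "inf u (real n *\<^sub>R v) \<le> 0" for n :: nat
  proof (induction n)
    case (Suc n)
    have "inf u (real n *\<^sub>R v + v) \<le> inf u (real n *\<^sub>R v) + inf u v"
      by (rule inf_add_le) (use u v in \<open>auto simp: scaleR_nonneg_nonneg\<close>)
    also have "\<dots> \<le> 0" using Suc uv by simp
    finally show ?case by (simp add: scaleR_add_left add.commute)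
  qed (simp add: u)
  have "pos_proj v u \<le> 0" by (rule pos_proj_le) (rule *)
  then show ?thesis using u by (simp add: bproj_pos antisym pos_proj_nonneg)
qed

text \<open>For \<open>u \<ge> 0\<close>, the part of \<open>bproj v u\<close> outside the band of
  \<open>P\<close> is disjoint from \<open>v\<close>, hence killed by \<open>bproj v\<close>, which
  also fixes it; so it is zero.\<close>

lemma bproj_least:
  assumes P: "is_bp P" and Pv: "P v = v"
  shows "P (bproj v x) = bproj v x"
proof -
  note J = is_bp_bproj
  have *: "P (bproj v u) = bproj v u" if u: "0 \<le> u" for u
  proof -
    let ?z = "bproj v u - P (bproj v u)"
    have Ju: "0 \<le> bproj v u" using bp_nonneg[OF J u] .
    have z0: "0 \<le> ?z" and z1: "?z \<le> bproj v u"
      using bp_below[OF P Ju] bp_nonneg[OF P Ju] by auto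
    have "P ?z = 0" by (simp add: bp_diff[OF P] bp_idem[OF P])
    then have "inf v ?z = 0" by (rule bp_disjoint[OF P v z0 Pv])
    then have "bproj v ?z = 0" using bproj_disjoint[OF z0] by (simp add: inf.commute)
    moreover have "bproj v ?z = ?z"
      by (rule bp_fixed_below[OF J _ z0 z1]) (rule bp_idem[OF J])
    ultimately show ?thesis by simp
  qed
  have "P (bproj v (sup x 0 - sup (- x) 0)) = bproj v (sup x 0 - sup (- x) 0)"
    by (simp add: bp_diff[OF P] bp_diff[OF J] *)
  then show ?thesis by (simp only: pos_part_diff)
qed

lemma bproj_null:
  assumes P: "is_bp P" and Pv: "P v = 0"
  shows "P (bproj v x) = 0"
  using bproj_least[OF bp_compl[OF P]] unfolding Pv by simp

end

lemma rabs_eq_0: "rabs x = 0 \<Longrightarrow> x = (0::'u::{ordered_real_vector,lattice})"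
  using rabs_ge[of x] by (metis neg_le_0_iff_le order.antisym)

text \<open>Case distinction on an event: \<open>Q\<close> inside \<open>P\<close>, \<open>R\<close>
  outside. The event of holding a short position is updated in this way.\<close>

lemma bp_cond:
  fixes P Q R :: "'u::{ordered_real_vector,lattice} \<Rightarrow> 'u"
  assumes P: "is_bp P" and Q: "is_bp Q" and R: "is_bp R"
  shows "is_bp (\<lambda>x. P (Q x) + (R x - P (R x)))"
proof -
  let ?W = "\<lambda>x. P (Q x) + (R x - P (R x))"
  note lin = bp_add[OF P] bp_add[OF Q] bp_add[OF R] bp_scaleR[OF P] bp_scaleR[OF Q] bp_scaleR[OF R]
    bp_diff[OF P] bp_diff[OF Q] bp_diff[OF R] bp_idem[OF P] bp_idem[OF Q] bp_idem[OF R]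
  have "?W (?W x) = ?W x" for x
    using bp_commute[OF P Q] bp_commute[OF P R] by (simp add: lin)
  moreover have "?W u \<le> u" if "0 \<le> u" for u
    using add_mono[OF bp_mono[OF P bp_below[OF Q that]] bp_compl_mono[OF P bp_below[OF R that]]]
    by simp
  moreover have "0 \<le> ?W u" if "0 \<le> u" for u
    using that bp_nonneg[OF P bp_nonneg[OF Q that]] bp_below[OF P bp_nonneg[OF R that]] by simp
  ultimately show ?thesis
    unfolding is_bp_def by (simp add: lin algebra_simps)
qed

text \<open>The event {w > 0}; for \<open>w = x - c e\<close> it is {x > c}, and its value at
  \<open>e\<close> is the indicator.\<close>

definition pos_event :: "'u::{ordered_real_vector,conditionally_complete_lattice} \<Rightarrow> 'u \<Rightarrow> 'u" where
  "pos_event w = bproj (sup w 0)"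

lemma is_bp_pos_event: "is_bp (pos_event w)"
  unfolding pos_event_def by (rule is_bp_bproj) simp

lemma pos_event_self: "pos_event w w = sup w 0"
proof -
  have "bproj (sup w 0) (sup (- w) 0) = 0"
    by (rule bproj_disjoint) (simp_all add: inf.commute pos_neg_disjoint)
  then have "bproj (sup w 0) (sup w 0 - sup (- w) 0) = sup w 0"
    by (simp add: bp_diff is_bp_bproj bproj_self)
  then show ?thesis unfolding pos_event_def by (simp only: pos_part_diff)
qed

lemma pos_event_nonneg: "is_bp P \<Longrightarrow> 0 \<le> P (pos_event w w)"
  unfolding pos_event_self by (rule bp_nonneg) auto

lemma pos_event_null:
  assumes "is_bp P" "P (pos_event w w) = 0"
  shows "P w \<le> 0"
  using bp_mono[OF assms(1), of w "sup w 0"] assms(2) unfolding pos_event_self by simp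

section \<open>Order ideals with a weak unit and conditional expectations\<close>

locale unit_ideal =
  fixes X :: "'u::{ordered_real_vector,conditionally_complete_lattice} set" and e :: 'u
  assumes X_riesz: "riesz_subspace X" and X_dense: "order_dense X"
    and X_complete: "dedekind_complete_in X" and X_unit: "weak_order_unit X e"
begin

lemma X_zero: "0 \<in> X"
  and X_add: "x \<in> X \<Longrightarrow> y \<in> X \<Longrightarrow> x + y \<in> X"
  and X_sup: "x \<in> X \<Longrightarrow> y \<in> X \<Longrightarrow> sup x y \<in> X"
  and X_scaleR: "x \<in> X \<Longrightarrow> c *\<^sub>R x \<in> X"
  using X_riesz unfolding riesz_subspace_def by auto

lemma X_uminus: "x \<in> X \<Longrightarrow> - x \<in> X"
  using X_scaleR[of x "-1"] by simp

lemma X_diff: "x \<in> X \<Longrightarrow> y \<in> X \<Longrightarrow> x - y \<in> X"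
  using X_add[of x "- y"] by (simp add: X_uminus)

lemma X_rabs: "x \<in> X \<Longrightarrow> rabs x \<in> X"
  unfolding rabs_def by (simp add: X_sup X_uminus)

lemma X_inf: "x \<in> X \<Longrightarrow> y \<in> X \<Longrightarrow> inf x y \<in> X"
  using X_uminus[OF X_sup[OF X_uminus X_uminus]] by (simp add: neg_sup)

lemma e_X: "e \<in> X" and e_nonneg: "0 \<le> e"
  using X_unit unfolding weak_order_unit_def by auto

lemma dense_le:
  assumes "\<And>a. a \<in> X \<Longrightarrow> 0 \<le> a \<Longrightarrow> a \<le> sup w 0 \<Longrightarrow> a \<le> 0"
  shows "w \<le> 0"
proof (rule ccontr)
  assume "\<not> w \<le> 0"
  then have "sup w 0 \<noteq> 0" by (metis sup_ge1)
  then have "0 < sup w 0" by (simp add: order.not_eq_order_implies_strict)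
  then obtain a where "a \<in> X" "0 < a" "a \<le> sup w 0"
    using X_dense unfolding order_dense_def by blast
  with assms[of a] show False by (simp add: less_le_not_le)
qed

text \<open>An order dense Dedekind complete Riesz subspace is an order ideal.\<close>
lemma X_ideal_pos:
  assumes x: "x \<in> X" and u: "0 \<le> u" "u \<le> x"
  shows "u \<in> X"
proof -
  let ?A = "{a \<in> X. 0 \<le> a \<and> a \<le> u}"
  have "?A \<subseteq> X" "?A \<noteq> {}" "\<exists>b\<in>X. \<forall>a\<in>?A. a \<le> b"
    using X_zero u x by (auto intro: order.trans)
  then obtain s where s: "is_lub_in X ?A s"
    using X_complete unfolding dedekind_complete_in_def by meson
  then have sX: "s \<in> X" and ub: "\<And>a. a \<in> ?A \<Longrightarrow> a \<le> s"
    and lst: "\<And>b. b \<in> X \<Longrightarrow> (\<And>a. a \<in> ?A \<Longrightarrow> a \<le> b) \<Longrightarrow> s \<le> b"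
    unfolding is_lub_in_def by auto
  have "u - s \<le> 0"
  proof (rule dense_le)
    fix a assume a: "a \<in> X" "0 \<le> a" "a \<le> sup (u - s) 0"
    have "s \<le> s - a"
    proof (rule lst)
      show "s - a \<in> X" using sX a by (simp add: X_diff)
      fix c assume c: "c \<in> ?A"
      have "c + a \<le> c + sup (u - s) 0" using a by simp
      also have "\<dots> = sup (c + (u - s)) (c + 0)" by (rule add_sup)
      also have "\<dots> \<le> u" using ub[OF c] c by (simp add: algebra_simps)
      finally have "c + a \<in> ?A" using a c by (simp add: X_add)
      from ub[OF this] show "c \<le> s - a" by (simp add: algebra_simps)
    qed
    then show "a \<le> 0" by simp
  qed
  \<comment> \<open>\<open>s\<close> is least only among the bounds in \<open>X\<close>, so
    \<open>s \<le> u\<close> is not automatic: an element \<open>a\<close> of \<open>X\<close> in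
    the gap would make \<open>s - a\<close> a smaller bound.\<close>
  moreover have "s - u \<le> 0"
  proof (rule dense_le)
    fix a assume a: "a \<in> X" "0 \<le> a" "a \<le> sup (s - u) 0"
    have "s \<le> s - a"
    proof (rule lst)
      show "s - a \<in> X" using sX a by (simp add: X_diff)
      fix c assume c: "c \<in> ?A"
      have "c + a \<le> c + sup (s - u) 0" using a by simp
      also have "\<dots> = sup (c + (s - u)) (c + 0)" by (rule add_sup)
      also have "\<dots> \<le> s" using ub[OF c] c by (simp add: algebra_simps add_mono)
      finally show "c \<le> s - a" by (simp add: algebra_simps)
    qed
    then show "a \<le> 0" by simp
  qed
  ultimately have "u = s" by simp
  with sX show ?thesis by simp
qed

lemma X_between:
  assumes "a \<in> X" "b \<in> X" "a \<le> u" "u \<le> b"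
  shows "u \<in> X"
proof -
  have "u - a \<in> X" by (rule X_ideal_pos[of "b - a"]) (use assms in \<open>auto simp: X_diff\<close>)
  then have "a + (u - a) \<in> X" by (rule X_add[OF assms(1)])
  then show ?thesis by simp
qed

lemma X_ideal:
  assumes "x \<in> X" "rabs u \<le> x"
  shows "u \<in> X"
proof (rule X_between)
  show "- x \<in> X" "x \<in> X" using assms by (simp_all add: X_uminus)
  show "- x \<le> u" "u \<le> x"
    using assms(2) rabs_ge[of u] by (metis minus_le_iff order.trans)+
qed

lemma X_bp: "is_bp P \<Longrightarrow> x \<in> X \<Longrightarrow> P x \<in> X"
  by (rule X_ideal[OF X_rabs bp_rabs_le])

lemma unit_disjoint:
  assumes "0 \<le> u" "inf u e = 0"
  shows "u = 0"
proof -
  have "u \<le> 0"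
  proof (rule dense_le)
    fix a assume a: "a \<in> X" "0 \<le> a" "a \<le> sup u 0"
    with assms have "inf a e \<le> inf u e" by (intro inf_mono) (simp_all add: sup_absorb1)
    with assms a e_nonneg have "inf a e = 0" by (metis le_infI order.antisym)
    with a e_nonneg have "disj a e" unfolding disj_def by (simp add: rabs_eq)
    with X_unit a show "a \<le> 0" unfolding weak_order_unit_def by auto
  qed
  with assms show ?thesis by simp
qed

text \<open>Events can be tested on \<open>e\<close> alone: for \<open>u \<ge> 0\<close>,
  \<open>P u\<close> lies in the band of \<open>P\<close> and \<open>e\<close> in its null band, so
  the two are disjoint.\<close>

lemma bp_zeroI:
  assumes P: "is_bp P" and Pe: "P e = 0"
  shows "P x = 0"
proof -
  have *: "P u = 0" if u: "0 \<le> u" for u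
  proof (rule unit_disjoint)
    show "0 \<le> P u" by (rule bp_nonneg[OF P u])
    show "inf (P u) e = 0"
      by (rule bp_disjoint[OF P]) (simp_all add: P u Pe e_nonneg bp_nonneg bp_idem)
  qed
  have "P (sup x 0 - sup (- x) 0) = 0"
    by (simp add: bp_diff[OF P] *)
  then show ?thesis by (simp only: pos_part_diff)
qed

lemma bp_absorbI:
  assumes P: "is_bp P" and R: "is_bp R" and le: "P e \<le> R e"
  shows "R (P x) = P x" "P (R x) = P x"
proof -
  have "R (P e) = P e"
    by (rule bp_fixed_below[OF R _ _ le]) (simp_all add: bp_idem[OF R] bp_nonneg[OF P] e_nonneg)
  then have "P x - R (P x) = 0"
    using bp_zeroI[OF bp_comp[OF bp_compl[OF R] P]] by simp
  then show "R (P x) = P x" by simp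
  then show "P (R x) = P x" using bp_commute[OF P R] by simp
qed

lemma bp_eqI:
  assumes "is_bp P" "is_bp R" "P e = R e"
  shows "P x = R x"
  using assms bp_absorbI[of P R x] bp_absorbI[of R P x] by simp

lemma bproj_unit: "bproj e x = x"
  by (rule bp_eqI[OF is_bp_bproj bp_id]) (simp_all add: e_nonneg bproj_self)

lemma unit_lub: "0 \<le> x \<Longrightarrow> is_lub (range (\<lambda>n::nat. inf x (real n *\<^sub>R e))) x"
  using bproj_lub[OF e_nonneg, of x] by (simp add: bproj_unit)

section \<open>Countable unions of events\<close>

definition bp_SUP :: "(nat \<Rightarrow> 'u \<Rightarrow> 'u) \<Rightarrow> 'u \<Rightarrow> 'u" where
  "bp_SUP A = bproj (Sup (range (\<lambda>n. A n e)))"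

context
  fixes A :: "nat \<Rightarrow> 'u \<Rightarrow> 'u"
  assumes A: "\<And>n. is_bp (A n)"
begin

lemma events_lub: "is_lub (range (\<lambda>n. A n e)) (Sup (range (\<lambda>n. A n e)))"
  by (rule is_lub_cSup[of _ e]) (auto intro: bp_below[OF A e_nonneg])

lemma is_bp_SUP: "is_bp (bp_SUP A)"
proof -
  have "0 \<le> A 0 e" by (rule bp_nonneg[OF A e_nonneg])
  also have "\<dots> \<le> Sup (range (\<lambda>n. A n e))" by (rule is_lub_upper[OF events_lub]) blast
  finally show ?thesis unfolding bp_SUP_def by (rule is_bp_bproj)
qed

lemma bp_SUP_absorb: "bp_SUP A (A n x) = A n x" "A n (bp_SUP A x) = A n x"
proof -
  let ?q = "Sup (range (\<lambda>n. A n e))"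
  have n0: "0 \<le> A n e" by (rule bp_nonneg[OF A e_nonneg])
  have le: "A n e \<le> ?q" by (rule is_lub_upper[OF events_lub]) blast
  with n0 have q0: "0 \<le> ?q" by (rule order.trans)
  have "bp_SUP A (A n e) = A n e"
    unfolding bp_SUP_def
    by (rule bp_fixed_below[OF is_bp_bproj[OF q0] bproj_self[OF q0] n0 le])
  then have "A n e \<le> bp_SUP A e"
    using bp_mono[OF is_bp_SUP bp_below[OF A e_nonneg, of n]] by simp
  then show "bp_SUP A (A n x) = A n x" "A n (bp_SUP A x) = A n x"
    by (rule bp_absorbI[OF A is_bp_SUP])+
qed

text \<open>The projection \<open>?W\<close> onto the band of \<open>z\<close> annihilates every
  \<open>A n e\<close>, hence by order continuity their supremum; so the union is disjoint from
  \<open>z\<close>.\<close>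

lemma bp_SUP_null:
  assumes "\<And>n. A n z = 0"
  shows "bp_SUP A z = 0"
proof -
  let ?q = "Sup (range (\<lambda>n. A n e))"
  let ?W = "bproj (rabs z)"
  have W: "is_bp ?W" by (rule is_bp_bproj[OF rabs_nonneg])
  have "A n (rabs z) = 0" for n
    by (simp add: bp_rabs[OF A] assms rabs_eq)
  then have "A n (?W e) = 0" for n by (rule bproj_null[OF rabs_nonneg A])
  then have "?W (A n e) = 0" for n by (simp add: bp_commute[OF W A])
  then have "is_lub (range (\<lambda>n::nat. 0)) (?W ?q)"
    using bp_lub[OF W events_lub] by simp
  then have Wq: "?W ?q = 0"
    by (rule is_lub_unique) (auto intro: is_lubI)
  have "0 \<le> A 0 e" by (rule bp_nonneg[OF A e_nonneg])
  also have "\<dots> \<le> ?q" by (rule is_lub_upper[OF events_lub]) blast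
  finally have q0: "0 \<le> ?q" .
  have "?W (bp_SUP A (rabs z)) = 0"
    unfolding bp_SUP_def by (rule bproj_null[OF q0 W Wq])
  then have "bp_SUP A (rabs z) = 0"
    by (simp add: bp_commute[OF W is_bp_SUP] bproj_self[OF rabs_nonneg])
  then have "rabs (bp_SUP A z) = 0" by (simp add: bp_rabs[OF is_bp_SUP])
  then show ?thesis by (rule rabs_eq_0)
qed

text \<open>\<open>e\<close> minus the supremum vanishes on every \<open>A n\<close>, hence on the
  union; so the union has the same value at \<open>e\<close> as at the supremum of the
  \<open>A n e\<close>.\<close>

lemma bp_SUP_lub: "is_lub (range (\<lambda>n. A n e)) (bp_SUP A e)"
proof -
  have "is_lub (range (\<lambda>n. bp_SUP A (A n e))) (bp_SUP A (Sup (range (\<lambda>n. A n e))))"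
    by (rule bp_lub[OF is_bp_SUP events_lub])
  then have 1: "is_lub (range (\<lambda>n. A n e)) (bp_SUP A (Sup (range (\<lambda>n. A n e))))"
    by (simp add: bp_SUP_absorb)
  have "A n (e - Sup (range (\<lambda>n. A n e))) = 0" for n
  proof (rule order.antisym)
    have "A n (A n e) \<le> A n (Sup (range (\<lambda>n. A n e)))"
      by (intro bp_mono[OF A] is_lub_upper[OF events_lub]) blast
    then show "A n (e - Sup (range (\<lambda>n. A n e))) \<le> 0" by (simp add: bp_diff[OF A] bp_idem[OF A])
    have "Sup (range (\<lambda>n. A n e)) \<le> e"
      by (rule is_lub_least[OF events_lub]) (auto intro: bp_below[OF A e_nonneg])
    then show "0 \<le> A n (e - Sup (range (\<lambda>n. A n e)))" by (intro bp_nonneg[OF A]) simp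
  qed
  then have "bp_SUP A (e - Sup (range (\<lambda>n. A n e))) = 0" by (rule bp_SUP_null)
  with 1 show ?thesis by (simp add: bp_diff[OF is_bp_SUP])
qed

end

section \<open>Conditional expectations: monotone convergence and measurable events\<close>

context
  fixes E :: "'u \<Rightarrow> 'u"
  assumes E: "cond_exp X e E"
begin

lemma ce_closed: "x \<in> X \<Longrightarrow> E x \<in> X"
  and ce_add: "x \<in> X \<Longrightarrow> y \<in> X \<Longrightarrow> E (x + y) = E x + E y"
  and ce_scaleR: "x \<in> X \<Longrightarrow> E (c *\<^sub>R x) = c *\<^sub>R E x"
  and ce_nonneg: "x \<in> X \<Longrightarrow> 0 \<le> x \<Longrightarrow> 0 \<le> E x"
  and ce_idem: "x \<in> X \<Longrightarrow> E (E x) = E x"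
  and ce_unit: "E e = e"
  and ce_range: "riesz_subspace (E ` X)"
  using E unfolding cond_exp_def by simp_all

lemma ce_zero: "E 0 = 0"
  using ce_scaleR[OF X_zero, of 0] by simp

lemma ce_diff: "x \<in> X \<Longrightarrow> y \<in> X \<Longrightarrow> E (x - y) = E x - E y"
  using ce_add[of x "- y"] ce_scaleR[of y "-1"] by (simp add: X_uminus)

lemma ce_mono: "x \<in> X \<Longrightarrow> y \<in> X \<Longrightarrow> x \<le> y \<Longrightarrow> E x \<le> E y"
  using ce_nonneg[of "y - x"] by (simp add: X_diff ce_diff)

lemma ce_strict:
  assumes "x \<in> X" "0 \<le> x" "E x \<le> 0"
  shows "x = 0"
proof -
  have "E (rabs x) = 0" using assms ce_nonneg[of x] by (metis rabs_eq order.antisym)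
  with assms(1) E show ?thesis unfolding cond_exp_def by blast
qed

text \<open>Monotone convergence, with a bound that may lie outside \<open>X\<close>. Order
  continuity is phrased for directed sets decreasing to 0, hence the differences
  \<open>s - f n\<close>.\<close>

lemma ce_lub_le:
  assumes f: "\<And>n. f n \<in> X" and mono: "incseq f" and s: "is_lub (range f) s" "s \<in> X"
    and y: "\<And>n. E (f n) \<le> y"
  shows "E s \<le> y"
proof -
  let ?D = "range (\<lambda>n. s - f n)"
  have "?D \<subseteq> X" "?D \<noteq> {}" using f s by (auto simp: X_diff)
  moreover have "down_directed ?D"
    unfolding down_directed_def
  proof clarify
    fix n m
    have "f n \<le> f (max n m)" "f m \<le> f (max n m)" using mono by (simp_all add: incseqD)
    then show "\<exists>c\<in>?D. c \<le> s - f n \<and> c \<le> s - f m" by (auto simp: algebra_simps)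
  qed
  moreover have "is_glb_in X ?D 0"
    unfolding is_glb_in_def
  proof (intro conjI ballI impI)
    show "0 \<in> X" by (rule X_zero)
    show "0 \<le> a" if "a \<in> ?D" for a using that is_lub_upper[OF s(1)] by auto
    show "b \<le> 0" if "\<forall>a\<in>?D. b \<le> a" for b
    proof -
      have "s \<le> s - b"
        by (rule is_lub_least[OF s(1)]) (use that in \<open>auto simp: algebra_simps\<close>)
      then show ?thesis by simp
    qed
  qed
  ultimately have glb: "is_glb_in X (E ` ?D) 0"
    using E unfolding cond_exp_def by blast
  \<comment> \<open>Only elements of \<open>X\<close> can be compared with the infimum in
    \<open>X\<close>; cutting \<open>y\<close> at \<open>E s\<close> brings it into
    \<open>X\<close>.\<close>
  let ?y = "inf y (E s)"
  have Ef: "E (f n) \<le> ?y" for n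
    using y is_lub_upper[OF s(1), of "f n"] by (simp add: ce_mono f s)
  have yX: "?y \<in> X"
    by (rule X_between[OF ce_closed[OF f[of 0]] ce_closed[OF s(2)] Ef]) simp
  have "E s - ?y \<le> 0"
  proof -
    have "E s - ?y \<in> X" by (simp add: X_diff yX ce_closed s)
    moreover have "\<forall>a\<in>E ` ?D. E s - ?y \<le> a"
      using Ef by (auto simp: ce_diff f s intro: diff_left_mono)
    ultimately show ?thesis using glb unfolding is_glb_in_def by blast
  qed
  then have "E s \<le> ?y" by simp
  also have "\<dots> \<le> y" by simp
  finally show ?thesis .
qed

lemma incseq_inf_unit:
  fixes x v :: 'u
  assumes "0 \<le> v"
  shows "incseq (\<lambda>n. inf x (real n *\<^sub>R v))"
proof (rule incseq_SucI)
  fix n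
  show "inf x (real n *\<^sub>R v) \<le> inf x (real (Suc n) *\<^sub>R v)"
    by (intro inf_mono scaleR_right_mono) (simp_all add: assms)
qed

text \<open>Truncations of \<open>x\<close> at \<open>n e\<close> are sent by \<open>P\<close> below
  \<open>n P e\<close>, which \<open>E\<close> fixes, so their expectations stay in the band of
  \<open>P\<close>; monotone convergence carries this to \<open>x\<close>.\<close>

lemma ce_commute_half:
  assumes P: "is_bp P" and Pe: "E (P e) = P e" and x: "x \<in> X" "0 \<le> x"
  shows "E (P x) \<le> P (E (P x))"
proof (rule ce_lub_le)
  let ?f = "\<lambda>n::nat. inf x (real n *\<^sub>R e)"
  have fX: "?f n \<in> X" for n by (simp add: X_inf X_scaleR e_X x)
  show "P (?f n) \<in> X" for n by (rule X_bp[OF P fX])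
  show "incseq (\<lambda>n. P (?f n))"
    using incseq_inf_unit[OF e_nonneg, of x] unfolding incseq_def by (blast intro: bp_mono[OF P])
  show "is_lub (range (\<lambda>n. P (?f n))) (P x)"
    by (rule bp_lub[OF P unit_lub[OF x(2)]])
  show "P x \<in> X" by (rule X_bp[OF P x(1)])
  show "E (P (?f n)) \<le> P (E (P x))" for n
  proof -
    have f0: "0 \<le> ?f n" using x e_nonneg by (simp add: scaleR_nonneg_nonneg)
    have "P (?f n) \<le> real n *\<^sub>R P e"
      using bp_mono[OF P, of "?f n" "real n *\<^sub>R e"] by (simp add: bp_scaleR[OF P])
    then have "E (P (?f n)) \<le> E (real n *\<^sub>R P e)"
      by (intro ce_mono) (simp_all add: X_bp[OF P] fX X_scaleR e_X)
    then have le: "E (P (?f n)) \<le> real n *\<^sub>R P e" by (simp add: ce_scaleR X_bp[OF P] e_X Pe)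
    have "P (E (P (?f n))) = E (P (?f n))"
    proof (rule bp_fixed_below[OF P _ _ le])
      show "P (real n *\<^sub>R P e) = real n *\<^sub>R P e" by (simp add: bp_scaleR[OF P] bp_idem[OF P])
      show "0 \<le> E (P (?f n))" by (intro ce_nonneg X_bp[OF P] fX bp_nonneg[OF P] f0)
    qed
    moreover have "E (P (?f n)) \<le> E (P x)"
      by (intro ce_mono X_bp[OF P] fX x bp_mono[OF P]) simp
    ultimately show ?thesis using bp_mono[OF P] by metis
  qed
qed

text \<open>Pulling out a known factor: \<open>ce_commute_half\<close> for \<open>P\<close> and for
  its complement shows that \<open>E\<close> preserves both bands.\<close>

lemma ce_commute:
  assumes P: "is_bp P" and Pe: "E (P e) = P e" and x: "x \<in> X"
  shows "E (P x) = P (E x)"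
proof -
  have *: "E (P u) = P (E u)" if u: "u \<in> X" "0 \<le> u" for u
  proof -
    have PuX: "P u \<in> X" by (rule X_bp[OF P u(1)])
    have "0 \<le> E (P u)" by (rule ce_nonneg[OF PuX bp_nonneg[OF P u(2)]])
    then have 1: "P (E (P u)) = E (P u)"
      by (rule order.antisym[OF bp_below[OF P] ce_commute_half[OF P Pe u]])
    have "E (u - P u) \<le> E (u - P u) - P (E (u - P u))"
      by (rule ce_commute_half[OF bp_compl[OF P]]) (simp_all add: ce_diff e_X X_bp[OF P] Pe ce_unit u)
    then have "P (E (u - P u)) \<le> 0" by simp
    moreover have "0 \<le> E (u - P u)"
      by (intro ce_nonneg X_diff u PuX) (simp add: bp_below[OF P] u)
    then have "0 \<le> P (E (u - P u))" by (rule bp_nonneg[OF P])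
    ultimately have "P (E (u - P u)) = 0" by simp
    with 1 show ?thesis by (simp add: ce_diff u PuX bp_diff[OF P])
  qed
  have pX: "sup x 0 \<in> X" "sup (- x) 0 \<in> X" using x by (simp_all add: X_sup X_uminus X_zero)
  have "E (P (sup x 0 - sup (- x) 0)) = P (E (sup x 0 - sup (- x) 0))"
    by (simp add: bp_diff[OF P] ce_diff pX X_bp[OF P] *)
  then show ?thesis by (simp only: pos_part_diff)
qed

lemma ce_fixed_iff: "x \<in> E ` X \<longleftrightarrow> x \<in> X \<and> E x = x"
  using ce_closed ce_idem by force

lemma ce_fixed_sup: "x \<in> X \<Longrightarrow> y \<in> X \<Longrightarrow> E x = x \<Longrightarrow> E y = y \<Longrightarrow> E (sup x y) = sup x y"
  using ce_range ce_fixed_iff unfolding riesz_subspace_def by metis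

lemma ce_fixed_inf:
  assumes "x \<in> X" "y \<in> X" "E x = x" "E y = y"
  shows "E (inf x y) = inf x y"
proof -
  have m: "E (- z) = - z" if "z \<in> X" "E z = z" for z
    using ce_scaleR[OF that(1), of "-1"] that by simp
  have "E (sup (- x) (- y)) = sup (- x) (- y)"
    by (rule ce_fixed_sup) (use assms m in \<open>simp_all add: X_uminus\<close>)
  then have "E (- sup (- x) (- y)) = - sup (- x) (- y)"
    by (intro m) (simp_all add: X_sup X_uminus assms)
  then show ?thesis by (simp only: neg_sup minus_minus)
qed

text \<open>Monotone convergence along \<open>inf e (n v)\<close> gives only
  \<open>E ?p \<le> ?p\<close>; the difference has expectation zero, so strict positivity gives
  equality.\<close>

lemma ce_bproj:
  assumes v: "v \<in> X" "0 \<le> v" "E v = v"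
  shows "E (bproj v e) = bproj v e"
proof -
  let ?p = "bproj v e"
  let ?f = "\<lambda>n::nat. inf e (real n *\<^sub>R v)"
  note J = is_bp_bproj[OF v(2)]
  have pX: "?p \<in> X" by (rule X_bp[OF J e_X])
  have fX: "?f n \<in> X" for n by (simp add: X_inf X_scaleR e_X v)
  note l = bproj_lub[OF v(2) e_nonneg]
  have "E ?p \<le> ?p"
  proof (rule ce_lub_le[OF fX incseq_inf_unit[OF v(2)] l pX])
    fix n
    have "E (?f n) = ?f n"
      by (rule ce_fixed_inf) (simp_all add: e_X v X_scaleR ce_unit ce_scaleR)
    also have "\<dots> \<le> ?p" by (rule is_lub_upper[OF l]) blast
    finally show "E (?f n) \<le> ?p" .
  qed
  then have "?p - E ?p = 0"
    by (intro ce_strict) (simp_all add: X_diff pX ce_closed ce_diff ce_idem)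
  then show ?thesis by simp
qed

lemma ce_pos_event: "w \<in> X \<Longrightarrow> E w = w \<Longrightarrow> E (pos_event w e) = pos_event w e"
  unfolding pos_event_def
  by (rule ce_bproj) (simp_all add: X_sup X_zero ce_fixed_sup ce_zero)

end

end

section \<open>Downcrossings\<close>

lemma bp_comp_diff:
  fixes P R :: "'u::{ordered_real_vector,lattice} \<Rightarrow> 'u"
  assumes "is_bp P" "is_bp R"
  shows "is_bp (\<lambda>x. P (x - R x))"
  by (rule bp_comp[OF assms(1) bp_compl[OF assms(2)]])

context unit_ideal
begin

text \<open>Point-free encoding: for all \<open>a < b\<close>, the bands on which \<open>f\<close>
  is eventually at least \<open>a\<close>, or eventually at most \<open>b\<close>, exhaust the
  space, since a nonzero \<open>z\<close> must meet one of them.\<close>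

definition no_oscillation :: "(nat \<Rightarrow> 'u) \<Rightarrow> bool" where
  "no_oscillation f \<longleftrightarrow> (\<forall>a b z. a < b \<longrightarrow> 0 \<le> z \<longrightarrow>
     (\<forall>P n. is_bp P \<longrightarrow>
        (\<forall>k\<ge>n. 0 \<le> P (f k - a *\<^sub>R e)) \<or> (\<forall>k\<ge>n. P (f k - b *\<^sub>R e) \<le> 0) \<longrightarrow> P z = 0) \<longrightarrow> z = 0)"

end

locale filtered = unit_ideal X e
  for X :: "'u::{ordered_real_vector,conditionally_complete_lattice} set" and e +
  fixes T :: "'u \<Rightarrow> 'u" and Tn :: "nat \<Rightarrow> 'u \<Rightarrow> 'u"
  assumes T: "cond_exp X e T" and Tn: "filtration X e T Tn"
begin

lemma Tn_ce: "cond_exp X e (Tn n)"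
  using Tn unfolding filtration_def by blast

lemma Tn_min: "x \<in> X \<Longrightarrow> Tn n (Tn m x) = Tn (min n m) x"
  using Tn unfolding filtration_def by blast

lemma T_Tn: "x \<in> X \<Longrightarrow> T (Tn n x) = T x"
  using Tn unfolding filtration_def by (metis ce_idem[OF T] ce_closed[OF T])

lemma fixed_later:
  assumes "x \<in> X" "Tn n x = x" "n \<le> m"
  shows "Tn m x = x"
  using Tn_min[OF assms(1), of m n] assms by (simp add: min_def split: if_splits)

text \<open>Condition at time \<open>n\<close> first: \<open>Tn n\<close> commutes with the
  measurable event \<open>P\<close>. Applied to the increments of a trading gain.\<close>

lemma T_predictable:
  assumes P: "is_bp P" "Tn n (P e) = P e" and x: "x \<in> X" "Tn n x = 0"
  shows "T (P x) = 0"
proof -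
  have "T (P x) = T (Tn n (P x))" by (simp add: T_Tn X_bp P x)
  also have "Tn n (P x) = P 0" using ce_commute[OF Tn_ce P x(1)] x(2) by simp
  finally show ?thesis by (simp add: bp_zero[OF P(1)] ce_zero[OF T])
qed

end

text \<open>The domination is one-sided and \<open>C\<close> may lie outside \<open>X\<close>; this
  is what the jump hypothesis yields for the stopped martingale.\<close>

locale bounded_martingale = filtered X e T Tn
  for X :: "'u::{ordered_real_vector,conditionally_complete_lattice} set" and e T Tn +
  fixes y g :: "nat \<Rightarrow> 'u" and C :: 'u
  assumes y_X: "y n \<in> X" and y_adapted: "Tn n (y n) = y n" and y_step: "Tn n (y (Suc n)) = y n"
    and g_X: "g n \<in> X" and g_nonneg: "0 \<le> g n" and y_le_g: "y n \<le> g n" and T_g: "T (g n) \<le> C"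
begin

definition hi :: "real \<Rightarrow> nat \<Rightarrow> 'u \<Rightarrow> 'u" where
  "hi b n = pos_event (y n - b *\<^sub>R e)"

definition lo :: "real \<Rightarrow> nat \<Rightarrow> 'u \<Rightarrow> 'u" where
  "lo a n = pos_event (a *\<^sub>R e - y n)"

text \<open>The event that a short position is held after observing \<open>y n\<close>: it is opened at the start or
  above the level \<open>b\<close> and closed below the level \<open>a\<close>.\<close>
primrec short :: "real \<Rightarrow> real \<Rightarrow> nat \<Rightarrow> 'u \<Rightarrow> 'u" where
  "short a b 0 = (\<lambda>x. x - lo a 0 x)"
| "short a b (Suc n) = (\<lambda>x. short a b n (x - lo a (Suc n) x)
     + (hi b (Suc n) x - short a b n (hi b (Suc n) x)))"

text \<open>The position is short from the start, so the first passage below \<open>a\<close> counts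
  even if \<open>y\<close> was never above \<open>b\<close>; the count thus also controls the event
  of ever falling below \<open>a\<close>.\<close>

primrec crossings :: "real \<Rightarrow> real \<Rightarrow> nat \<Rightarrow> 'u" where
  "crossings a b 0 = lo a 0 e"
| "crossings a b (Suc n) = crossings a b n + short a b n (lo a (Suc n) e)"

primrec gain :: "real \<Rightarrow> real \<Rightarrow> nat \<Rightarrow> 'u" where
  "gain a b 0 = 0"
| "gain a b (Suc n) = gain a b n - short a b n (y (Suc n) - y n)"

lemma is_bp_hi: "is_bp (hi b n)" and is_bp_lo: "is_bp (lo a n)"
  unfolding hi_def lo_def by (rule is_bp_pos_event)+

lemma lo_null: "is_bp P \<Longrightarrow> (\<And>x. P (lo a n x) = 0) \<Longrightarrow> P (a *\<^sub>R e - y n) \<le> 0"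
  unfolding lo_def by (rule pos_event_null)

lemma hi_null: "is_bp P \<Longrightarrow> (\<And>x. P (hi b n x) = 0) \<Longrightarrow> P (y n - b *\<^sub>R e) \<le> 0"
  unfolding hi_def by (rule pos_event_null)

lemma is_bp_short: "is_bp (short a b n)"
proof (induction n)
  case 0
  show ?case by (simp add: bp_compl is_bp_lo)
next
  case (Suc n)
  show ?case
    unfolding short.simps by (rule bp_cond[OF Suc bp_compl[OF is_bp_lo] is_bp_hi])
qed

lemma Tn_e_multiple: "Tn n (c *\<^sub>R e) = c *\<^sub>R e"
  by (simp add: ce_scaleR[OF Tn_ce e_X] ce_unit[OF Tn_ce])

lemma hi_measurable: "Tn n (hi b n e) = hi b n e"
  unfolding hi_def
  by (rule ce_pos_event[OF Tn_ce])
    (simp_all add: X_diff y_X X_scaleR e_X ce_diff[OF Tn_ce] y_adapted Tn_e_multiple)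

lemma lo_measurable: "Tn n (lo a n e) = lo a n e"
  unfolding lo_def
  by (rule ce_pos_event[OF Tn_ce])
    (simp_all add: X_diff y_X X_scaleR e_X ce_diff[OF Tn_ce] y_adapted Tn_e_multiple)

lemma short_measurable: "Tn n (short a b n e) = short a b n e"
proof (induction n)
  case 0
  show ?case
    by (simp add: ce_diff[OF Tn_ce] X_bp is_bp_lo e_X lo_measurable ce_unit[OF Tn_ce])
next
  case (Suc n)
  note S = is_bp_short[of a b n]
  have hiX: "hi b (Suc n) e \<in> X" and loX: "lo a (Suc n) e \<in> X"
    by (simp_all add: X_bp is_bp_lo is_bp_hi e_X)
  have Se: "Tn (Suc n) (short a b n e) = short a b n e"
    by (rule fixed_later[OF _ Suc]) (simp_all add: X_bp S e_X)
  have c: "Tn (Suc n) (short a b n x) = short a b n x" if "x \<in> X" "Tn (Suc n) x = x" for x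
    using ce_commute[OF Tn_ce S Se that(1)] that(2) by simp
  show ?case
    unfolding short.simps
    by (simp add: ce_add[OF Tn_ce] ce_diff[OF Tn_ce] X_bp S X_diff e_X hiX loX c hi_measurable
        lo_measurable ce_unit[OF Tn_ce])
qed

lemma crossings_X: "crossings a b n \<in> X"
  by (induction n) (simp_all add: X_bp is_bp_lo is_bp_short e_X X_add)

lemma gain_X: "gain a b n \<in> X"
  by (induction n) (simp_all add: X_bp is_bp_short X_diff X_zero y_X)

lemma T_gain: "T (gain a b n) = 0"
proof (induction n)
  case (Suc n)
  have "T (short a b n (y (Suc n) - y n)) = 0"
    by (rule T_predictable[OF is_bp_short short_measurable])
      (simp_all add: X_diff y_X ce_diff[OF Tn_ce] y_step y_adapted)
  then show ?case
    by (simp add: Suc ce_diff[OF T] gain_X X_bp is_bp_short X_diff y_X)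
qed (simp add: ce_zero[OF T])

text \<open>Each completed downcrossing earns at least \<open>b - a\<close>, and an open short position was taken at
  a price of at least \<open>b\<close>, or at time \<open>0\<close>.\<close>
lemma gain_ge:
  "(b - a) *\<^sub>R crossings a b n + (y 0 - b *\<^sub>R e) \<le> gain a b n + short a b n (y n - b *\<^sub>R e)"
proof (induction n)
  case 0
  have "0 \<le> lo a 0 (a *\<^sub>R e - y 0)"
    unfolding lo_def by (rule pos_event_nonneg[OF bp_id])
  then show ?case
    by (simp add: bp_diff[OF is_bp_lo] bp_scaleR[OF is_bp_lo] algebra_simps)
next
  case (Suc n)
  let ?S = "short a b n" and ?L = "lo a (Suc n)" and ?H = "hi b (Suc n)"
  note S = is_bp_short[of a b n]
  have 1: "0 \<le> ?S (?L (a *\<^sub>R e - y (Suc n)))"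
    unfolding lo_def by (rule pos_event_nonneg[OF S])
  have "0 \<le> ?H (y (Suc n) - b *\<^sub>R e)"
    unfolding hi_def by (rule pos_event_nonneg[OF bp_id])
  then have 2: "0 \<le> ?H (y (Suc n) - b *\<^sub>R e) - ?S (?H (y (Suc n) - b *\<^sub>R e))"
    using bp_below[OF S] by simp
  let ?l = "\<lambda>n. (b - a) *\<^sub>R crossings a b n + (y 0 - b *\<^sub>R e)"
  let ?r = "\<lambda>n. gain a b n + short a b n (y n - b *\<^sub>R e)"
  \<comment> \<open>In one step the right side gains on the left exactly two nonnegative terms: one
    for closing below \<open>a\<close>, one for opening above \<open>b\<close>.\<close>
  have "?r (Suc n) - ?l (Suc n) = (?r n - ?l n) + (?S (?L (a *\<^sub>R e - y (Suc n)))
      + (?H (y (Suc n) - b *\<^sub>R e) - ?S (?H (y (Suc n) - b *\<^sub>R e))))"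
    by (simp add: bp_diff[OF S] bp_diff[OF is_bp_lo] bp_diff[OF is_bp_hi] bp_scaleR[OF S]
        bp_scaleR[OF is_bp_lo] bp_scaleR[OF is_bp_hi] algebra_simps)
  also have "0 \<le> \<dots>" using Suc 1 2 by (intro add_nonneg_nonneg) simp_all
  finally show ?case by simp
qed

text \<open>The term \<open>\<bar>b\<bar> e\<close> absorbs \<open>- b e\<close> and keeps the
  majorant of \<open>y n - b e\<close> nonnegative, so that \<open>short\<close> can only decrease
  it.\<close>

definition crossing_bound :: "real \<Rightarrow> 'u" where
  "crossing_bound b = C + \<bar>b\<bar> *\<^sub>R e - T (y 0 - b *\<^sub>R e)"

lemma T_crossings: "(b - a) *\<^sub>R T (crossings a b n) \<le> crossing_bound b"
proof -
  let ?u = "g n + \<bar>b\<bar> *\<^sub>R e"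
  have uX: "?u \<in> X" by (simp add: X_add g_X X_scaleR e_X)
  have u0: "0 \<le> ?u" by (simp add: g_nonneg e_nonneg scaleR_nonneg_nonneg)
  have "(- b) *\<^sub>R e \<le> \<bar>b\<bar> *\<^sub>R e" by (intro scaleR_right_mono e_nonneg) simp
  then have "y n + (- b) *\<^sub>R e \<le> ?u" by (rule add_mono[OF y_le_g])
  then have "y n - b *\<^sub>R e \<le> ?u" by simp
  then have "short a b n (y n - b *\<^sub>R e) \<le> short a b n ?u" by (rule bp_mono[OF is_bp_short])
  also have "\<dots> \<le> ?u" by (rule bp_below[OF is_bp_short u0])
  finally have "(b - a) *\<^sub>R crossings a b n + (y 0 - b *\<^sub>R e) \<le> gain a b n + ?u"
    using gain_ge[of b a n] by (meson add_left_mono order.trans)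
  then have "T ((b - a) *\<^sub>R crossings a b n + (y 0 - b *\<^sub>R e)) \<le> T (gain a b n + ?u)"
    by (rule ce_mono[OF T, rotated -1])
      (simp_all add: X_add X_diff X_scaleR e_X y_X gain_X crossings_X uX)
  then have "(b - a) *\<^sub>R T (crossings a b n) + T (y 0 - b *\<^sub>R e) \<le> T (g n) + \<bar>b\<bar> *\<^sub>R e"
    by (simp add: ce_add[OF T] ce_scaleR[OF T] T_gain X_add X_diff X_scaleR e_X y_X gain_X
        crossings_X uX g_X ce_unit[OF T])
  also have "\<dots> \<le> C + \<bar>b\<bar> *\<^sub>R e" by (simp add: T_g)
  finally show ?thesis unfolding crossing_bound_def by (simp add: algebra_simps)
qed

lemma crossings_mono: "n \<le> m \<Longrightarrow> crossings a b n \<le> crossings a b m"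
  by (rule lift_Suc_mono_le) (simp_all add: bp_nonneg is_bp_short is_bp_lo e_nonneg)

lemma lo_hi_disjoint:
  assumes "a < b"
  shows "lo a n (hi b n x) = 0"
proof -
  let ?P = "\<lambda>x. lo a n (hi b n x)"
  have P: "is_bp ?P" by (rule bp_comp[OF is_bp_lo is_bp_hi])
  have "0 \<le> lo a n (hi b n (y n - b *\<^sub>R e))"
    unfolding hi_def by (rule pos_event_nonneg[OF is_bp_lo])
  moreover have "0 \<le> hi b n (lo a n (a *\<^sub>R e - y n))"
    unfolding lo_def by (rule pos_event_nonneg[OF is_bp_hi])
  ultimately have "0 \<le> ?P (y n - b *\<^sub>R e) + ?P (a *\<^sub>R e - y n)"
    by (simp add: bp_commute[OF is_bp_lo is_bp_hi])
  then have "(b - a) *\<^sub>R ?P e \<le> 0"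
    by (simp add: bp_diff[OF P] bp_scaleR[OF P] algebra_simps)
  then have "(1 / (b - a)) *\<^sub>R ((b - a) *\<^sub>R ?P e) \<le> (1 / (b - a)) *\<^sub>R 0"
    using assms by (intro scaleR_left_mono) auto
  then have "?P e \<le> 0" using assms by simp
  with bp_nonneg[OF P e_nonneg] have "?P e = 0" by simp
  then show ?thesis by (rule bp_zeroI[OF P])
qed

lemma short_lo:
  assumes "a < b"
  shows "short a b n (lo a n x) = 0"
  by (cases n) (simp_all add: bp_idem is_bp_lo bp_zero is_bp_short bp_commute[OF is_bp_hi is_bp_lo]
      lo_hi_disjoint assms)

text \<open>Being out of the short position requires having closed it at least once, since it was
  open before the first observation.\<close>

lemma crossings_ge: "e - short a b n e \<le> crossings a b n"
proof (induction n)
  case (Suc n)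
  note S = is_bp_short[of a b n]
  have "0 \<le> hi b (Suc n) e" by (rule bp_nonneg[OF is_bp_hi e_nonneg])
  then have "0 \<le> hi b (Suc n) e - short a b n (hi b (Suc n) e)" using bp_below[OF S] by simp
  from add_mono[OF Suc this] show ?case by (simp add: bp_diff[OF S] algebra_simps)
qed simp

lemma lo_le_crossings:
  assumes "a < b"
  shows "lo a n e \<le> crossings a b n"
proof -
  have "lo a n e - short a b n (lo a n e) \<le> e - short a b n e"
    by (rule bp_compl_mono[OF is_bp_short bp_below[OF is_bp_lo e_nonneg]])
  also have "\<dots> \<le> crossings a b n" by (rule crossings_ge)
  finally show ?thesis by (simp add: short_lo assms)
qed

section \<open>Maximal inequality and finiteness of the number of crossings\<close>

definition ever_lo :: "real \<Rightarrow> 'u \<Rightarrow> 'u" where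
  "ever_lo a = bp_SUP (lo a)"

lemma is_bp_ever_lo: "is_bp (ever_lo a)"
  unfolding ever_lo_def by (rule is_bp_SUP[OF is_bp_lo])

lemma ever_lo_compl: "0 \<le> (y n - a *\<^sub>R e) - ever_lo a (y n - a *\<^sub>R e)"
proof -
  let ?P = "\<lambda>x. x - ever_lo a x"
  have P: "is_bp ?P" by (rule bp_compl[OF is_bp_ever_lo])
  have "?P (lo a n (a *\<^sub>R e - y n)) = 0"
    unfolding ever_lo_def by (simp add: bp_SUP_absorb(1)[of "lo a", OF is_bp_lo])
  then have "?P (a *\<^sub>R e - y n) \<le> 0" unfolding lo_def by (rule pos_event_null[OF P])
  then show ?thesis by (simp add: bp_diff[OF is_bp_ever_lo] algebra_simps)
qed

text \<open>The \<open>c n\<close> may have no common bound, so they are cut at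
  \<open>bp_SUP A e\<close>; the cut sequence still increases to it because
  \<open>A n e \<le> c n\<close>.\<close>

lemma T_le_of_events:
  assumes A: "\<And>n. is_bp (A n)" and c: "incseq c" "\<And>n. 0 \<le> c n" and cX: "\<And>n. c n \<in> X"
    and Ac: "\<And>n. A n e \<le> c n" and Tc: "\<And>n. T (c n) \<le> w"
  shows "T (bp_SUP A e) \<le> w"
proof (rule ce_lub_le[OF T, where f = "\<lambda>n. inf (bp_SUP A e) (c n)"])
  let ?s = "bp_SUP A e"
  note S = is_bp_SUP[of A, OF A]
  show sX: "?s \<in> X" by (rule X_bp[OF S e_X])
  show "inf ?s (c n) \<in> X" for n by (rule X_inf[OF sX cX])
  show "incseq (\<lambda>n. inf ?s (c n))"
    unfolding incseq_def using c(1) by (blast intro: inf_mono dest: incseqD)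
  show "is_lub (range (\<lambda>n. inf ?s (c n))) ?s"
  proof (rule is_lubI)
    show "u \<le> ?s" if "u \<in> range (\<lambda>n. inf ?s (c n))" for u using that by auto
    fix u assume u: "\<And>v. v \<in> range (\<lambda>n. inf ?s (c n)) \<Longrightarrow> v \<le> u"
    show "?s \<le> u"
    proof (rule is_lub_least[OF bp_SUP_lub[of A, OF A]], clarify)
      fix n
      have "A n e \<le> ?s" by (rule is_lub_upper[OF bp_SUP_lub[of A, OF A]]) blast
      with Ac have "A n e \<le> inf ?s (c n)" by simp
      also have "\<dots> \<le> u" by (rule u) blast
      finally show "A n e \<le> u" .
    qed
  qed
  have "T (inf ?s (c n)) \<le> T (c n)" for n
    by (rule ce_mono[OF T X_inf[OF sX cX] cX]) simp
  then show "T (inf ?s (c n)) \<le> w" for n using Tc by (rule order.trans)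
qed

text \<open>A maximal inequality of Doob type: the event of lying below \<open>a\<close> at time
  \<open>n\<close> is dominated by \<open>crossings a b n\<close>.\<close>

lemma T_ever_lo:
  assumes "a < b"
  shows "(b - a) *\<^sub>R T (ever_lo a e) \<le> crossing_bound b"
proof -
  have "T (ever_lo a e) \<le> (1 / (b - a)) *\<^sub>R crossing_bound b"
    unfolding ever_lo_def
  proof (rule T_le_of_events[OF is_bp_lo])
    show "incseq (crossings a b)" unfolding incseq_def by (simp add: crossings_mono)
    show "0 \<le> crossings a b n" for n
      using lo_le_crossings[OF assms] bp_nonneg[OF is_bp_lo e_nonneg] by (rule order.trans[rotated])
    have "(1 / (b - a)) *\<^sub>R ((b - a) *\<^sub>R T (crossings a b n)) \<le> (1 / (b - a)) *\<^sub>R crossing_bound b" for n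
      using assms by (intro scaleR_left_mono T_crossings) simp
    then show "T (crossings a b n) \<le> (1 / (b - a)) *\<^sub>R crossing_bound b" for n using assms by simp
  qed (simp_all add: crossings_X lo_le_crossings assms)
  then have "(b - a) *\<^sub>R T (ever_lo a e) \<le> (b - a) *\<^sub>R ((1 / (b - a)) *\<^sub>R crossing_bound b)"
    using assms by (intro scaleR_left_mono) auto
  then show ?thesis using assms by simp
qed

text \<open>\<open>z\<close> may lie outside \<open>X\<close>, where strict positivity of
  \<open>T\<close> says nothing; \<open>inf z e\<close> lies in \<open>X\<close>, and its vanishing
  forces \<open>z = 0\<close>.\<close>

lemma positive_zeroI:
  assumes z: "0 \<le> z" and "T (inf z e) \<le> 0"
  shows "z = 0"
proof -
  have iX: "inf z e \<in> X" by (rule X_ideal_pos[OF e_X]) (use z e_nonneg in auto)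
  have "inf z e = 0" by (rule ce_strict[OF T iX]) (use z e_nonneg assms(2) in auto)
  with z show ?thesis by (rule unit_disjoint)
qed

lemma bp_inf_unit_le:
  assumes P: "is_bp P" and "P z = z" "0 \<le> z"
  shows "T (inf z e) \<le> T (P e)"
proof (rule ce_mono[OF T _ X_bp[OF P e_X]])
  show "inf z e \<in> X" by (rule X_ideal_pos[OF e_X]) (use assms e_nonneg in auto)
  have "inf z e = P (inf z e)"
    by (rule bp_fixed_below[OF P assms(2), symmetric]) (use assms e_nonneg in auto)
  also have "\<dots> \<le> P e" by (intro bp_mono[OF P]) simp
  finally show "inf z e \<le> P e" .
qed

text \<open>\<open>z\<close> lies in every event of falling below \<open>-j\<close>. The maximal
  inequality with \<open>b = 0\<close> bounds \<open>j T (inf z e)\<close> independently of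
  \<open>j\<close>.\<close>

lemma bounded_below:
  assumes z: "0 \<le> z" and lo: "\<And>j::nat. z - ever_lo (- real j) z = 0"
  shows "z = 0"
proof (rule positive_zeroI[OF z], rule archimedean_le_0)
  fix j :: nat
  show "real j *\<^sub>R T (inf z e) \<le> crossing_bound 0"
  proof (cases "j = 0")
    case True
    \<comment> \<open>For \<open>j = 0\<close> the bound itself must be nonnegative; this comes from
      the maximal inequality at level -1.\<close>
    have "0 \<le> (0 - (-1)) *\<^sub>R T (ever_lo (-1) e)"
      by (simp add: ce_nonneg[OF T] X_bp is_bp_ever_lo e_X bp_nonneg e_nonneg)
    also have "\<dots> \<le> crossing_bound 0" by (rule T_ever_lo) simp
    finally show ?thesis by (simp add: True)
  next
    case False
    have "T (inf z e) \<le> T (ever_lo (- real j) e)"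
      using lo[of j] z by (intro bp_inf_unit_le is_bp_ever_lo) simp_all
    then have "real j *\<^sub>R T (inf z e) \<le> (0 - (- real j)) *\<^sub>R T (ever_lo (- real j) e)"
      by (simp add: scaleR_left_mono)
    also have "\<dots> \<le> crossing_bound 0" by (rule T_ever_lo) (use False in simp)
    finally show ?thesis .
  qed
qed

text \<open>Borel--Cantelli: the numbers of downcrossings have bounded conditional expectations, so
  almost everywhere only finitely many downcrossings occur. After the last one, a short position
  once opened stays open and \<open>y\<close> remains above \<open>a\<close>, or none is opened and \<open>y\<close> remains below \<open>b\<close>.\<close>
lemma finitely_many_crossings:
  assumes ab: "a < b" and z: "0 \<le> z"
    and last: "\<And>n. z - bp_SUP (\<lambda>k x. short a b (n + k) (lo a (Suc (n + k)) x)) z = 0"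
  shows "z = 0"
proof -
  let ?R = "\<lambda>n. bp_SUP (\<lambda>k x. short a b (n + k) (lo a (Suc (n + k)) x))"
  let ?D = "crossings a b"
  have E: "is_bp (\<lambda>x. short a b k (lo a (Suc k) x))" for k
    by (rule bp_comp[OF is_bp_short is_bp_lo])
  have Rbp: "is_bp (?R n)" for n by (rule is_bp_SUP) (rule E)
  have TD: "T (?D n) \<le> (1 / (b - a)) *\<^sub>R crossing_bound b" for n
  proof -
    have "(1 / (b - a)) *\<^sub>R ((b - a) *\<^sub>R T (?D n)) \<le> (1 / (b - a)) *\<^sub>R crossing_bound b"
      using ab by (intro scaleR_left_mono T_crossings) simp
    then show ?thesis using ab by simp
  qed
  define S where "S = Sup (range (\<lambda>n. T (?D n)))"
  have S: "is_lub (range (\<lambda>n. T (?D n))) S"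
    unfolding S_def by (rule is_lub_cSup) (use TD in auto)
  have TR: "T (?R n e) \<le> S - T (?D n)" for n
  proof (rule T_le_of_events[OF E])
    let ?c = "\<lambda>k. ?D (Suc (n + k)) - ?D n"
    show "incseq ?c" unfolding incseq_def by (intro allI impI diff_right_mono crossings_mono) simp
    show "0 \<le> ?c k" for k using crossings_mono[of n "Suc (n + k)" a b] by simp
    show "?c k \<in> X" for k by (simp only: X_diff crossings_X)
    show "short a b (n + k) (lo a (Suc (n + k)) e) \<le> ?c k" for k
      using crossings_mono[of n "n + k" a b] by simp
    have "T (?c k) = T (?D (Suc (n + k))) - T (?D n)" for k by (rule ce_diff[OF T crossings_X crossings_X])
    moreover have "T (?D k) \<le> S" for k by (rule is_lub_upper[OF S]) blast
    ultimately show "T (?c k) \<le> S - T (?D n)" for k by (simp only: diff_right_mono)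
  qed
  \<comment> \<open>Crossings after time \<open>n\<close> still contribute at least
    \<open>T (inf z e)\<close>, so every \<open>T (?D n)\<close> stays that far below
    \<open>S\<close>. This replaces the convergence of tails to zero.\<close>
  have "S \<le> S - T (inf z e)"
  proof (rule is_lub_least[OF S], clarify)
    fix n
    have "T (inf z e) \<le> T (?R n e)"
      using last[of n] z by (intro bp_inf_unit_le Rbp) simp_all
    also note TR
    finally show "T (?D n) \<le> S - T (inf z e)" by (simp add: algebra_simps)
  qed
  then show ?thesis by (intro positive_zeroI z) simp
qed

theorem martingale_no_oscillation: "no_oscillation y"
  unfolding no_oscillation_def
proof (intro allI impI)
  fix a b :: real and z :: 'u
  assume ab: "a < b" and z: "0 \<le> z"
    and Pz: "\<forall>P n. is_bp P \<longrightarrow>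
        (\<forall>k\<ge>n. 0 \<le> P (y k - a *\<^sub>R e)) \<or> (\<forall>k\<ge>n. P (y k - b *\<^sub>R e) \<le> 0) \<longrightarrow> P z = 0"
  let ?S = "short a b" and ?L = "lo a" and ?H = "hi b"
  note Sbp = is_bp_short[of a b]
  show "z = 0"
  proof (rule finitely_many_crossings[OF ab z])
    fix n
    let ?E = "\<lambda>k x. ?S (n + k) (?L (Suc (n + k)) x)"
    \<comment> \<open>The event that no short position is closed after time
      \<open>n\<close>.\<close>
    let ?N = "\<lambda>x. x - bp_SUP ?E x"
    have E: "is_bp (?E k)" for k by (rule bp_comp[OF is_bp_short is_bp_lo])
    have N: "is_bp ?N" by (rule bp_compl[OF is_bp_SUP[of ?E, OF E]])
    have EN: "?S m (?L (Suc m) (?N x)) = 0" if nm: "n \<le> m" for m x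
    proof -
      obtain k where m: "m = n + k" using le_Suc_ex[OF nm] by blast
      have "?E k (bp_SUP ?E x) = ?E k x"
        by (rule bp_SUP_absorb(2)[where A = ?E and n = k and x = x, OF E])
      then show ?thesis by (simp add: m bp_diff[OF Sbp] bp_diff[OF is_bp_lo])
    qed
    have step: "?S (Suc m) (?N x) = ?S m (?N x) + (?H (Suc m) (?N x) - ?S m (?H (Suc m) (?N x)))"
      if "n \<le> m" for m x
      using EN[OF that, of x] by (simp add: bp_diff[OF Sbp])
    \<comment> \<open>Within \<open>?N\<close>, a position short at time \<open>k\<close> is short
      at all later times.\<close>
    have absorb: "?S k (?S (k + i) (?N x)) = ?S k (?N x)" if "n \<le> k" for k i x
    proof (induction i)
      case 0
      show ?case by (simp add: bp_idem[OF Sbp])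
    next
      case (Suc i)
      have SH: "?S k (?S (k + i) (?H (Suc (k + i)) (?N x))) = ?S k (?H (Suc (k + i)) (?N x))"
        using arg_cong[OF Suc, of "?H (Suc (k + i))"]
        by (simp only: bp_commute[OF is_bp_hi Sbp])
      have "?S k (?S (k + Suc i) (?N x)) = ?S k (?S (k + i) (?N x)
          + (?H (Suc (k + i)) (?N x) - ?S (k + i) (?H (Suc (k + i)) (?N x))))"
        using step[of "k + i" x] that by (simp only: add_Suc_right trans_le_add1)
      also have "\<dots> = ?S k (?S (k + i) (?N x))
          + (?S k (?H (Suc (k + i)) (?N x)) - ?S k (?S (k + i) (?H (Suc (k + i)) (?N x))))"
        by (simp only: bp_add[OF Sbp] bp_diff[OF Sbp])
      also have "\<dots> = ?S k (?N x)" by (simp only: SH Suc diff_self add_0_right)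
      finally show ?case .
    qed
    \<comment> \<open>First alternative: short at time \<open>k\<close>, so \<open>y\<close> stays
      above \<open>a\<close> from \<open>Suc k\<close> on.\<close>
    have SN: "?S k (?N z) = 0" if nk: "n \<le> k" for k
    proof -
      let ?P = "\<lambda>x. ?S k (?N x)"
      have P: "is_bp ?P" by (rule bp_comp[OF Sbp N])
      have "0 \<le> ?P (y m - a *\<^sub>R e)" if m: "Suc k \<le> m" for m
      proof -
        obtain i where i: "m = Suc (k + i)" using le_Suc_ex[OF m] by auto
        have "?P (?L m x) = 0" for x
        proof -
          have "?P (?L m x) = ?S k (?S (k + i) (?N (?L m x)))" by (simp only: absorb[OF nk, of i])
          also have "\<dots> = ?S k (?S (k + i) (?L m (?N x)))"
            by (simp only: bp_commute[OF N is_bp_lo, where x = x])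
          also have "\<dots> = ?S k 0" using EN[of "k + i"] nk by (simp only: i trans_le_add1)
          finally show ?thesis by (simp only: bp_zero[OF Sbp])
        qed
        then have "?P (a *\<^sub>R e - y m) \<le> 0" by (rule lo_null[OF P])
        then have "0 \<le> - ?P (a *\<^sub>R e - y m)" by simp
        also have "\<dots> = ?P (- (a *\<^sub>R e - y m))" by (rule bp_uminus[OF P, symmetric])
        finally show ?thesis by simp
      qed
      then show ?thesis using Pz P by blast
    qed
    \<comment> \<open>The event of being short at some time from \<open>n\<close> on. Off it and
      within \<open>?N\<close> no position is opened, so \<open>y\<close> stays below
      \<open>b\<close> after time \<open>n\<close>: the second alternative.\<close>
    let ?V = "bp_SUP (\<lambda>k. ?S (n + k))"
    have V: "is_bp ?V" by (rule is_bp_SUP) (rule Sbp)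
    let ?P = "\<lambda>x. ?N (x - ?V x)"
    have P: "is_bp ?P" by (rule bp_comp_diff[OF N V])
    have SP: "?S k (?P x) = 0" if nk: "n \<le> k" for k x
    proof -
      obtain i where k: "k = n + i" using le_Suc_ex[OF nk] by blast
      have "?S k (?P x) = ?N (?S k (x - ?V x))" by (rule bp_commute[OF Sbp N])
      also have "?S k (x - ?V x) = 0"
        unfolding k using bp_SUP_absorb(2)[of "\<lambda>k. ?S (n + k)" i x, OF Sbp] by (simp add: bp_diff[OF Sbp])
      also have "?N 0 = 0" by (rule bp_zero[OF N])
      finally show ?thesis .
    qed
    have "?P (y m - b *\<^sub>R e) \<le> 0" if m: "Suc n \<le> m" for m
    proof -
      obtain k where k: "m = Suc k" "n \<le> k" using m by (cases m) auto
      have "?P (?H m x) = 0" for x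
      proof -
        have *: "?N (x - ?V x) = ?P x" for x by simp
        have "?H m (?P x) = 0"
          using step[OF k(2), of "x - ?V x"] SP[of k] SP[of "Suc k"] k
          by (simp del: short.simps add: bp_commute[OF Sbp is_bp_hi] bp_zero[OF is_bp_hi])
        then show ?thesis using bp_commute[OF P is_bp_hi] by simp
      qed
      then show ?thesis by (rule hi_null[OF P])
    qed
    then have Pz0: "?P z = 0" using Pz P by blast
    have "?V (?N z) = 0" by (rule bp_SUP_null[OF Sbp]) (rule SN, simp)
    then have "?N (?V z) = 0" using bp_commute[OF V N, of z] by simp
    with Pz0 show "?N z = 0" by (simp only: bp_diff[OF N] diff_0_right)
  qed
qed

end

section \<open>Order convergence\<close>

context unit_ideal
begin

lemma unit_disjoint_scaled:
  assumes r: "0 < r" and t: "0 \<le> t" and i: "inf (r *\<^sub>R e) t = 0"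
  shows "t = 0"
proof -
  have "inf ((1 / r) *\<^sub>R t) e = (1 / r) *\<^sub>R inf (r *\<^sub>R e) t"
    using r by (subst scaleR_inf) (simp_all add: inf.commute)
  then have "inf ((1 / r) *\<^sub>R t) e = 0" by (simp only: i scaleR_zero_right)
  moreover have "0 \<le> (1 / r) *\<^sub>R t" using r t by (intro scaleR_nonneg_nonneg) simp_all
  ultimately have "(1 / r) *\<^sub>R t = 0" by (rule unit_disjoint[rotated])
  with r show ?thesis by simp
qed

text \<open>If \<open>L\<close> exceeds \<open>l\<close> by \<open>2\<delta>e\<close> on a band, then \<open>l \<ge> -J + i\<delta>\<close> there for every \<open>i\<close>, by induction:
  where \<open>l\<close> lies between two consecutive levels, \<open>L\<close> exceeds the upper level by a fixed amount.\<close>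
lemma le_of_no_gap_approx:
  assumes gap: "\<And>a b. a < b \<Longrightarrow> inf (sup (L - b *\<^sub>R e) 0) (sup (a *\<^sub>R e - l) 0) = 0"
    and l: "(- J) *\<^sub>R e \<le> l" "l \<le> J *\<^sub>R e" and d: "0 < d"
  shows "L - l \<le> (2 * d) *\<^sub>R e"
proof -
  let ?w = "L - l - (2 * d) *\<^sub>R e"
  let ?W = "pos_event ?w"
  let ?c = "\<lambda>i::nat. - J + real i * d"
  let ?B = "\<lambda>i. pos_event (?c i *\<^sub>R e - l)"
  note W = is_bp_pos_event[of ?w] and B = is_bp_pos_event
  have WB: "?W (?B i x) = 0" for i x
  proof (induction i arbitrary: x)
    case 0
    have "sup (?c 0 *\<^sub>R e - l) 0 = 0" using l(1) by (intro sup_absorb2) simp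
    then have "?B 0 x = 0"
      unfolding pos_event_def using bproj_null[OF _ bp_id, of 0 x] by simp
    then show ?case by (simp only: bp_zero[OF W])
  next
    case (Suc i)
    let ?V = "\<lambda>x. ?W (?B (Suc i) x)"
    \<comment> \<open>Within \<open>?V\<close>, \<open>l \<ge> ?c i e\<close> and
      \<open>L \<ge> l + 2 d e\<close>, so \<open>L \<ge> ?b e + (d / 2) e\<close>. The half step
      serves twice: \<open>?c (Suc i) < ?b\<close> allows \<open>gap\<close>, and \<open>L\<close>
      keeps a definite excess over \<open>?b e\<close>.\<close>
    let ?b = "?c (Suc i) + d / 2"
    let ?s = "sup (?c (Suc i) *\<^sub>R e - l) 0"
    have V: "is_bp ?V" by (rule bp_comp[OF W B])
    have "0 \<le> ?B (Suc i) (?W ?w)" by (rule pos_event_nonneg[OF B])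
    then have 1: "0 \<le> ?V ?w" by (simp only: bp_commute[OF W B])
    have "?V (?B i x) = 0" for x
      using Suc[of "?B (Suc i) x"] by (simp only: bp_commute[OF B B, of "?c (Suc i) *\<^sub>R e - l"])
    then have 2: "?V (?c i *\<^sub>R e - l) \<le> 0" by (rule pos_event_null[OF V])
    have "0 \<le> ?V ?w - ?V (?c i *\<^sub>R e - l)" using order.trans[OF 2 1] by simp
    also have "\<dots> = ?V (?w - (?c i *\<^sub>R e - l))" by (rule bp_diff[OF V, symmetric])
    also have "?w - (?c i *\<^sub>R e - l) = (L - ?b *\<^sub>R e) - (d / 2) *\<^sub>R e"
    proof -
      have "?b + d / 2 = 2 * d + ?c i" by (simp add: algebra_simps)
      then have "?b *\<^sub>R e + (d / 2) *\<^sub>R e = (2 * d) *\<^sub>R e + ?c i *\<^sub>R e"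
        by (simp only: scaleR_add_left[symmetric])
      then show ?thesis by (simp add: diff_diff_eq diff_diff_eq2)
    qed
    also have "?V \<dots> = ?V (L - ?b *\<^sub>R e) - (d / 2) *\<^sub>R ?V e"
      by (simp only: bp_diff[OF V] bp_scaleR[OF V])
    finally have 3: "(d / 2) *\<^sub>R ?V e \<le> ?V (L - ?b *\<^sub>R e)" by simp
    have Vs: "0 \<le> ?V ?s" by (rule bp_nonneg[OF V]) simp
    have re: "0 \<le> (d / 2) *\<^sub>R e" using d e_nonneg by (intro scaleR_nonneg_nonneg) simp_all
    let ?t = "inf ((d / 2) *\<^sub>R e) (?V ?s)"
    have "?V ?t = inf ((d / 2) *\<^sub>R ?V e) (?V ?s)"
      by (simp only: bp_inf[OF V] bp_scaleR[OF V] bp_idem[OF V])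
    also have "\<dots> \<le> inf (?V (sup (L - ?b *\<^sub>R e) 0)) (?V ?s)"
    proof (intro inf_mono order_refl)
      have "?V (L - ?b *\<^sub>R e) \<le> ?V (sup (L - ?b *\<^sub>R e) 0)" by (rule bp_mono[OF V]) simp
      with 3 show "(d / 2) *\<^sub>R ?V e \<le> ?V (sup (L - ?b *\<^sub>R e) 0)" by (rule order.trans)
    qed
    also have "\<dots> = ?V (inf (sup (L - ?b *\<^sub>R e) 0) ?s)" by (simp only: bp_inf[OF V])
    also have "inf (sup (L - ?b *\<^sub>R e) 0) ?s = 0" by (rule gap) (use d in simp)
    also have "?V 0 = 0" by (rule bp_zero[OF V])
    finally have Vt: "?V ?t \<le> 0" .
    have "?t - ?V ?t \<le> ?V ?s - ?V (?V ?s)" by (rule bp_compl_mono[OF V]) simp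
    then have "?t \<le> ?V ?t" by (simp only: bp_idem[OF V] diff_self diff_le_0_iff_le)
    with Vt have "?t \<le> 0" by (rule order.trans[rotated])
    moreover have "0 \<le> ?t" using re Vs by (rule le_infI)
    ultimately have "?t = 0" by (rule order.antisym)
    then have "?V ?s = 0" by (rule unit_disjoint_scaled[OF half_gt_zero[OF d] Vs])
    then have "?V (bproj ?s x) = 0" by (rule bproj_null[OF sup_ge2 V])
    then have "?V (?B (Suc i) x) = 0" unfolding pos_event_def .
    then show ?case by (simp only: bp_idem[OF B])
  qed
  \<comment> \<open>Then \<open>?c i \<ge> J + 1\<close>, so \<open>?c i e - l \<ge> e\<close>: the
    event \<open>?B i\<close> is everything, and its disjointness from \<open>?W\<close> makes
    \<open>?W\<close> void.\<close>
  obtain i :: nat where "2 * J + 1 \<le> real i * d"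
    using reals_Archimedean3[OF d] less_imp_le by blast
  then have "(J + 1) *\<^sub>R e \<le> ?c i *\<^sub>R e" by (intro scaleR_right_mono e_nonneg) simp
  moreover have "e + l \<le> (J + 1) *\<^sub>R e" using l(2) by (simp add: scaleR_add_left)
  ultimately have "e + l \<le> ?c i *\<^sub>R e" by (rule order.trans[rotated])
  then have ge: "e \<le> ?c i *\<^sub>R e - l" by (simp only: le_diff_eq)
  have "0 \<le> ?c i *\<^sub>R e - l" using e_nonneg ge by (rule order.trans)
  then have self: "?B i (?c i *\<^sub>R e - l) = ?c i *\<^sub>R e - l"
    unfolding pos_event_self by (rule sup_absorb1)
  have "?W (?c i *\<^sub>R e - l) = 0" using WB[of i "?c i *\<^sub>R e - l"] unfolding self .
  then have "?W e \<le> 0" using bp_mono[OF W ge] by simp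
  with bp_nonneg[OF W e_nonneg] have "?W e = 0" by (rule order.antisym[rotated])
  then have "?W ?w = 0" by (rule bp_zeroI[OF W])
  then have "sup ?w 0 = 0" unfolding pos_event_self .
  then have "?w \<le> 0" by (metis sup_ge1)
  then show ?thesis by simp
qed

lemma le_of_no_gap:
  assumes gap: "\<And>a b. a < b \<Longrightarrow> inf (sup (L - b *\<^sub>R e) 0) (sup (a *\<^sub>R e - l) 0) = 0"
    and l: "(- J) *\<^sub>R e \<le> l" "l \<le> J *\<^sub>R e"
  shows "L \<le> l"
proof -
  have "L - l \<le> 0"
  proof (rule archimedean_le_0)
    fix n :: nat
    show "real n *\<^sub>R (L - l) \<le> 2 *\<^sub>R e"
    proof (cases "n = 0")
      case False
      then have "L - l \<le> (2 * (1 / real n)) *\<^sub>R e"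
        by (intro le_of_no_gap_approx[OF gap l]) simp_all
      then have "real n *\<^sub>R (L - l) \<le> real n *\<^sub>R ((2 * (1 / real n)) *\<^sub>R e)"
        by (intro scaleR_left_mono) simp_all
      then show ?thesis using False by simp
    qed (simp add: e_nonneg scaleR_nonneg_nonneg)
  qed
  then show ?thesis by simp
qed

theorem no_oscillation_ord_conv:
  assumes osc: "no_oscillation f" and f: "\<And>n. (- J) *\<^sub>R e \<le> f n" "\<And>n. f n \<le> J *\<^sub>R e"
  shows "\<exists>v. ord_conv f v"
proof -
  define M where "M n = Sup (f ` {n..})" for n
  define m where "m n = Inf (f ` {n..})" for n
  have ba: "bdd_above (f ` {n..})" "bdd_below (f ` {n..})" for n
    using f unfolding bdd_above_def bdd_below_def by auto
  have fM: "f k \<le> M n" if "n \<le> k" for n k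
    unfolding M_def by (rule cSup_upper[OF _ ba(1)]) (use that in simp)
  have mf: "m n \<le> f k" if "n \<le> k" for n k
    unfolding m_def by (rule cInf_lower[OF _ ba(2)]) (use that in simp)
  have Mle: "M n \<le> u" if "\<And>k. n \<le> k \<Longrightarrow> f k \<le> u" for n u
    unfolding M_def by (rule cSup_least) (use that in auto)
  have mge: "u \<le> m n" if "\<And>k. n \<le> k \<Longrightarrow> u \<le> f k" for n u
    unfolding m_def by (rule cInf_greatest) (use that in auto)
  have mM: "m n \<le> M k" for n k
    using mf[of n "max n k"] fM[of k "max n k"] by (simp add: order.trans)
  define L where "L = Inf (range M)"
  define l where "l = Sup (range m)"
  have LM: "L \<le> M n" for n
    unfolding L_def by (rule cInf_lower) (use mM[of 0] in \<open>auto simp: bdd_below_def\<close>)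
  have ml: "m n \<le> l" for n
    unfolding l_def by (rule cSup_upper) (use mM[of _ 0] in \<open>auto simp: bdd_above_def\<close>)
  have Lge: "u \<le> L" if "\<And>n. u \<le> M n" for u
    unfolding L_def by (rule cInf_greatest) (use that in auto)
  have lle: "l \<le> u" if "\<And>n. m n \<le> u" for u
    unfolding l_def by (rule cSup_least) (use that in auto)
  have lL: "l \<le> L" by (intro lle Lge mM)
  have "L \<le> l"
  proof (rule le_of_no_gap)
    show "(- J) *\<^sub>R e \<le> l" using mge[of 0 "(- J) *\<^sub>R e"] f(1) ml[of 0] by (meson order.trans)
    show "l \<le> J *\<^sub>R e" by (rule lle) (meson mf f(2) order.trans order_refl)
    fix a b :: real assume "a < b"
    let ?z = "inf (sup (L - b *\<^sub>R e) 0) (sup (a *\<^sub>R e - l) 0)"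
    show "?z = 0"
    proof (rule osc[unfolded no_oscillation_def, rule_format, OF \<open>a < b\<close>])
      show z0: "0 \<le> ?z" by simp
      fix P n assume P: "is_bp P"
        and "(\<forall>k\<ge>n. 0 \<le> P (f k - a *\<^sub>R e)) \<or> (\<forall>k\<ge>n. P (f k - b *\<^sub>R e) \<le> 0)"
      then consider "\<And>k. n \<le> k \<Longrightarrow> 0 \<le> P (f k - a *\<^sub>R e)" | "\<And>k. n \<le> k \<Longrightarrow> P (f k - b *\<^sub>R e) \<le> 0"
        by blast
      then show "P ?z = 0"
      proof cases
        case 1
        \<comment> \<open>\<open>m n\<close> with its \<open>P\<close>-component replaced by
          \<open>a P e\<close>. This is still a lower bound of the tail, so \<open>m n\<close> is at
          least \<open>a e\<close> on \<open>P\<close>. The other case is dual.\<close>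
        let ?t = "m n - P (m n - a *\<^sub>R e)"
        have "?t \<le> m n"
        proof (rule mge, rule bp_split_le[OF P])
          fix k assume k: "n \<le> k"
          show "P ?t \<le> P (f k)" using 1[OF k] by (simp add: bp_diff[OF P] bp_idem[OF P])
          show "?t - P ?t \<le> f k - P (f k)"
            using bp_compl_mono[OF P mf[OF k]] by (simp add: bp_diff[OF P] bp_idem[OF P])
        qed
        then have "0 \<le> P (m n - a *\<^sub>R e)" by simp
        also have "\<dots> \<le> P (l - a *\<^sub>R e)" by (rule bp_mono[OF P]) (simp add: ml)
        finally have "P (a *\<^sub>R e - l) \<le> 0" by (simp add: bp_diff[OF P])
        then have "P (sup (a *\<^sub>R e - l) 0) = 0"
          by (simp only: bp_sup[OF P] bp_zero[OF P] sup_absorb2)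
        then show ?thesis by (rule bp_null_below[OF P _ z0]) simp
      next
        case 2
        let ?t = "M n - P (M n - b *\<^sub>R e)"
        have "M n \<le> ?t"
        proof (rule Mle, rule bp_split_le[OF P])
          fix k assume k: "n \<le> k"
          show "P (f k) \<le> P ?t" using 2[OF k] by (simp add: bp_diff[OF P] bp_idem[OF P])
          show "f k - P (f k) \<le> ?t - P ?t"
            using bp_compl_mono[OF P fM[OF k]] by (simp add: bp_diff[OF P] bp_idem[OF P])
        qed
        have "P (L - b *\<^sub>R e) \<le> P (M n - b *\<^sub>R e)" by (rule bp_mono[OF P]) (simp add: LM)
        also have "\<dots> \<le> 0" using \<open>M n \<le> ?t\<close> by simp
        finally have "P (sup (L - b *\<^sub>R e) 0) = 0"
          by (simp only: bp_sup[OF P] bp_zero[OF P] sup_absorb2)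
        then show ?thesis by (rule bp_null_below[OF P _ z0]) simp
      qed
    qed
  qed
  with lL have Ll: "l = L" by (rule order.antisym)
  have "ord_conv f L"
    unfolding ord_conv_def
  proof (intro exI[of _ "\<lambda>n. M n - m n"] conjI allI impI)
    fix n
    show "M (Suc n) - m (Suc n) \<le> M n - m n"
      by (intro diff_mono Mle mge fM mf) simp_all
    have "f n - L \<le> M n - m n" using fM[of n n] ml[of n] unfolding Ll by (intro diff_mono) simp_all
    moreover have "L - f n \<le> M n - m n" using mf[of n n] LM[of n] by (intro diff_mono) simp_all
    ultimately show "rabs (f n - L) \<le> M n - m n" by (intro rabs_leI) simp_all
  next
    fix w assume w: "\<forall>n. w \<le> M n - m n"
    have "w + m k \<le> M n" for k n
    proof -
      have "w \<le> M (max n k) - m (max n k)" using w by blast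
      also have "\<dots> \<le> M n - m k" by (intro diff_mono Mle mge fM mf) simp_all
      finally show ?thesis by (simp add: le_diff_eq)
    qed
    then have "w + m k \<le> L" for k by (intro Lge)
    then have "l \<le> L - w" by (intro lle) (simp add: le_diff_eq add.commute)
    then show "w \<le> 0" unfolding Ll by simp
  qed
  then show ?thesis ..
qed

text \<open>On the band of \<open>R\<close> nothing changes; off it the sequence is constantly 0,
  and \<open>a < b\<close> gives \<open>a \<le> 0\<close> or \<open>0 \<le> b\<close>.\<close>

lemma no_oscillation_bp:
  assumes osc: "no_oscillation f" and R: "is_bp R"
  shows "no_oscillation (\<lambda>n. R (f n))"
  unfolding no_oscillation_def
proof (intro allI impI)
  fix a b :: real and z :: 'u
  assume ab: "a < b" and z: "0 \<le> z"
    and H: "\<forall>P n. is_bp P \<longrightarrow> (\<forall>k\<ge>n. 0 \<le> P (R (f k) - a *\<^sub>R e)) \<or>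
        (\<forall>k\<ge>n. P (R (f k) - b *\<^sub>R e) \<le> 0) \<longrightarrow> P z = 0"
  have "R z = 0"
  proof (rule osc[unfolded no_oscillation_def, rule_format, OF ab bp_nonneg[OF R z]])
    fix P n assume P: "is_bp P"
      and A: "(\<forall>k\<ge>n. 0 \<le> P (f k - a *\<^sub>R e)) \<or> (\<forall>k\<ge>n. P (f k - b *\<^sub>R e) \<le> 0)"
    have eq: "P (R (R (f k) - c *\<^sub>R e)) = R (P (f k - c *\<^sub>R e))" for k c
    proof -
      have "R (R (f k) - c *\<^sub>R e) = R (f k - c *\<^sub>R e)" by (simp add: bp_diff[OF R] bp_idem[OF R])
      then show ?thesis by (simp only: bp_commute[OF P R])
    qed
    from A have "(\<forall>k\<ge>n. 0 \<le> P (R (R (f k) - a *\<^sub>R e))) \<or> (\<forall>k\<ge>n. P (R (R (f k) - b *\<^sub>R e)) \<le> 0)"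
      unfolding eq using bp_nonneg[OF R] bp_mono[OF R, of _ 0] bp_zero[OF R] by auto
    with H[rule_format, OF bp_comp[OF P R]] show "P (R z) = 0" by blast
  qed
  moreover have "z - R z = 0"
  proof (rule H[rule_format, OF bp_compl[OF R], of 0])
    let ?e = "e - R e"
    have e0: "0 \<le> ?e" using bp_below[OF R e_nonneg] by simp
    have eq: "(R (f k) - c *\<^sub>R e) - R (R (f k) - c *\<^sub>R e) = - (c *\<^sub>R ?e)" for k c
      by (simp add: bp_diff[OF R] bp_idem[OF R] bp_scaleR[OF R] scaleR_diff_right)
    have "a \<le> 0 \<or> 0 \<le> b" using ab by linarith
    then show "(\<forall>k\<ge>0. 0 \<le> (R (f k) - a *\<^sub>R e) - R (R (f k) - a *\<^sub>R e)) \<or>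
        (\<forall>k\<ge>0. (R (f k) - b *\<^sub>R e) - R (R (f k) - b *\<^sub>R e) \<le> 0)"
      unfolding eq using e0 by (auto simp: scaleR_nonneg_nonneg scaleR_nonpos_nonneg)
  qed
  ultimately show "z = 0" by simp
qed

end

section \<open>Stopping above a level\<close>

locale sequence_in = unit_ideal X e
  for X :: "'u::{ordered_real_vector,conditionally_complete_lattice} set" and e +
  fixes x :: "nat \<Rightarrow> 'u"
  assumes x_X: "x n \<in> X"
begin

definition above :: "nat \<Rightarrow> nat \<Rightarrow> 'u \<Rightarrow> 'u" where
  "above K n = pos_event (x n - real K *\<^sub>R e)"

definition ever_above :: "nat \<Rightarrow> 'u \<Rightarrow> 'u" where
  "ever_above K = bp_SUP (above K)"

text \<open>The projection onto the band on which \<open>sup x = \<infinity>\<close>.\<close>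
definition blowup :: "'u \<Rightarrow> 'u" where
  "blowup u = u - bp_SUP (\<lambda>K u. u - ever_above K u) u"

lemma is_bp_above: "is_bp (above K n)"
  unfolding above_def by (rule is_bp_pos_event)

lemma is_bp_ever_above: "is_bp (ever_above K)"
  unfolding ever_above_def by (rule is_bp_SUP[OF is_bp_above])

lemma is_bp_not_ever_above: "is_bp (\<lambda>u. u - ever_above K u)"
  by (rule bp_compl[OF is_bp_ever_above])

lemma is_bp_blowup: "is_bp blowup"
  unfolding blowup_def
  by (rule bp_compl[OF is_bp_SUP[of "\<lambda>K u. u - ever_above K u", OF is_bp_not_ever_above]])

lemma ever_above_blowup: "ever_above K (blowup u) = blowup u"
proof -
  let ?N = "\<lambda>K u. u - ever_above K u"
  have "?N K (bp_SUP ?N u) = ?N K u"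
    by (rule bp_SUP_absorb(2)[where A = ?N and n = K and x = u, OF is_bp_not_ever_above])
  moreover have "?N K (blowup u) = ?N K u - ?N K (bp_SUP ?N u)"
    unfolding blowup_def by (rule bp_diff[OF is_bp_not_ever_above])
  ultimately show ?thesis by simp
qed

lemma blowup_fixed:
  assumes "\<And>K. ever_above K z = z"
  shows "blowup z = z"
  unfolding blowup_def
  using bp_SUP_null[of "\<lambda>K u. u - ever_above K u", OF is_bp_not_ever_above, of z] assms by simp

lemma not_ever_above_le: "(x n - ever_above K (x n)) \<le> real K *\<^sub>R (e - ever_above K e)"
proof -
  note N = is_bp_not_ever_above[of K]
  have "above K n w - ever_above K (above K n w) = 0" for w
    unfolding ever_above_def using bp_SUP_absorb(1)[of "above K" n w, OF is_bp_above] by simp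
  then have "(x n - real K *\<^sub>R e) - ever_above K (x n - real K *\<^sub>R e) \<le> 0"
    unfolding above_def by (rule pos_event_null[OF N])
  then show ?thesis by (simp add: bp_diff[OF is_bp_ever_above] bp_scaleR[OF is_bp_ever_above] algebra_simps)
qed

lemma above_ge: "is_bp P \<Longrightarrow> real K *\<^sub>R P (above K n e) \<le> P (above K n (x n))"
proof -
  assume P: "is_bp P"
  have "0 \<le> P (above K n (x n - real K *\<^sub>R e))"
    unfolding above_def by (rule pos_event_nonneg[OF P])
  then show ?thesis
    by (simp add: bp_diff[OF P] bp_scaleR[OF P] bp_diff[OF is_bp_above] bp_scaleR[OF is_bp_above])
qed

text \<open>A Markov inequality without integration: on the band of \<open>P\<close>,
  \<open>K\<close> times the indicator of \<open>above K n\<close> is at most \<open>rabs m\<close>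
  for all \<open>n\<close>, hence so is \<open>K\<close> times that of \<open>ever_above K\<close>;
  now let \<open>K\<close> grow.\<close>

lemma bounded_null_blowup:
  assumes P: "is_bp P" and m: "\<And>n. P (x n) \<le> m"
  shows "P (blowup u) = 0"
proof (rule bp_zeroI[OF bp_comp[OF P is_bp_blowup]])
  let ?z = "P (blowup e)"
  have "?z \<le> 0"
  proof (rule archimedean_le_0)
    fix K :: nat
    have "blowup e \<le> ever_above K e"
      using bp_mono[OF is_bp_ever_above bp_below[OF is_bp_blowup e_nonneg]] by (simp add: ever_above_blowup)
    then have le: "?z \<le> P (ever_above K e)" by (rule bp_mono[OF P])
    have ub: "real K *\<^sub>R P (above K n e) \<le> rabs m" for n
    proof -
      have "real K *\<^sub>R P (above K n e) \<le> P (above K n (x n))" by (rule above_ge[OF P])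
      also have "\<dots> = above K n (P (x n))" by (rule bp_commute[OF P is_bp_above])
      also have "\<dots> \<le> above K n (rabs m)"
        by (rule bp_mono[OF is_bp_above]) (rule order.trans[OF m rabs_ge(1)])
      also have "\<dots> \<le> rabs m" by (rule bp_below[OF is_bp_above rabs_nonneg])
      finally show ?thesis .
    qed
    show "real K *\<^sub>R ?z \<le> rabs m"
    proof (cases "K = 0")
      case False
      have "P (above K n e) \<le> (1 / real K) *\<^sub>R rabs m" for n
        using scaleR_left_mono[OF ub[of n], of "1 / real K"] False by simp
      then have "P (ever_above K e) \<le> (1 / real K) *\<^sub>R rabs m"
        unfolding ever_above_def
        by (intro is_lub_least[OF bp_lub[OF P bp_SUP_lub[of "above K", OF is_bp_above]]]) auto
      with le have "?z \<le> (1 / real K) *\<^sub>R rabs m" by (rule order.trans)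
      from scaleR_left_mono[OF this, of "real K"] show ?thesis using False by simp
    qed (simp add: rabs_nonneg)
  qed
  moreover have "0 \<le> ?z" by (intro bp_nonneg[OF P] bp_nonneg[OF is_bp_blowup] e_nonneg)
  ultimately show "?z = 0" by (rule order.antisym)
qed

lemma convergent_null_blowup:
  assumes P: "is_bp P" and v: "ord_conv (\<lambda>n. P (x n)) v"
  shows "P (blowup u) = 0"
proof -
  obtain p where p: "\<And>n. p (Suc n) \<le> p n" "\<And>n. rabs (P (x n) - v) \<le> p n"
    using v unfolding ord_conv_def by blast
  have "P (x n) \<le> p 0 + v" for n
  proof -
    have "P (x n) - v \<le> p n" using rabs_ge(1) p(2) by (rule order.trans)
    also have "\<dots> \<le> p 0" by (rule lift_Suc_antimono_le[of p]) (simp_all add: p)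
    finally show ?thesis by (simp add: diff_le_eq)
  qed
  then show ?thesis by (rule bounded_null_blowup[OF P])
qed

end

section \<open>The stopped martingale and local convergence\<close>

locale jump_martingale = filtered X e T Tn + sequence_in X e x
  for X :: "'u::{ordered_real_vector,conditionally_complete_lattice} set" and e T Tn x +
  fixes w :: 'u
  assumes x_martingale: "martingale X Tn x"
    and T_jumps: "T (pmax (\<lambda>n. rabs (x (Suc n) - x n)) N) \<le> w"
begin

abbreviation jumps :: "nat \<Rightarrow> 'u" where
  "jumps \<equiv> pmax (\<lambda>n. rabs (x (Suc n) - x n))"

lemma x_step: "i \<le> j \<Longrightarrow> Tn i (x j) = x i"
  using x_martingale unfolding martingale_def by blast

primrec unstopped :: "nat \<Rightarrow> nat \<Rightarrow> 'u \<Rightarrow> 'u" where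
  "unstopped K 0 = (\<lambda>u. u - above K 0 u)"
| "unstopped K (Suc n) = (\<lambda>u. unstopped K n (u - above K (Suc n) u))"

text \<open>The update to \<open>x (Suc n)\<close> is governed by \<open>unstopped K n\<close>,
  known one step earlier, so the value at the first exceedance is kept with its overshoot.\<close>

primrec stopped :: "nat \<Rightarrow> nat \<Rightarrow> 'u" where
  "stopped K 0 = x 0"
| "stopped K (Suc n) = stopped K n - unstopped K n (stopped K n) + unstopped K n (x (Suc n))"

lemma is_bp_unstopped: "is_bp (unstopped K n)"
proof (induction n)
  case (Suc n)
  show ?case unfolding unstopped.simps by (rule bp_comp_diff[OF Suc is_bp_above])
qed (simp add: bp_compl is_bp_above)

lemma unstopped_Suc_absorb: "unstopped K (Suc n) (unstopped K n u) = unstopped K (Suc n) u"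
proof -
  note U = is_bp_unstopped[of K n] and A = is_bp_above[of K "Suc n"]
  have "unstopped K n (above K (Suc n) (unstopped K n u)) = unstopped K n (above K (Suc n) u)"
    by (simp only: bp_commute[OF A U] bp_idem[OF U])
  then show ?thesis by (simp add: bp_diff[OF U] bp_idem[OF U])
qed

lemma unstopped_stopped: "unstopped K n (stopped K n) = unstopped K n (x n)"
proof (induction n)
  case (Suc n)
  let ?U = "unstopped K (Suc n)"
  note U = is_bp_unstopped[of K "Suc n"]
  have "?U (stopped K (Suc n)) = ?U (stopped K n) - ?U (unstopped K n (stopped K n))
      + ?U (unstopped K n (x (Suc n)))"
    by (simp only: stopped.simps bp_add[OF U] bp_diff[OF U])
  then show ?case by (simp only: unstopped_Suc_absorb diff_self add_0)
qed simp

lemma above_measurable: "Tn n (above K n e) = above K n e"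
  unfolding above_def
  by (rule ce_pos_event[OF Tn_ce])
    (simp_all add: X_diff x_X X_scaleR e_X ce_diff[OF Tn_ce] x_step ce_scaleR[OF Tn_ce] ce_unit[OF Tn_ce])

lemma unstopped_measurable: "Tn n (unstopped K n e) = unstopped K n e"
proof (induction n)
  case 0
  show ?case
    by (simp add: ce_diff[OF Tn_ce] X_bp is_bp_above e_X above_measurable ce_unit[OF Tn_ce])
next
  case (Suc n)
  note U = is_bp_unstopped[of K n]
  have aX: "above K (Suc n) e \<in> X" by (rule X_bp[OF is_bp_above e_X])
  have Ue: "Tn (Suc n) (unstopped K n e) = unstopped K n e"
    by (rule fixed_later[OF X_bp[OF U e_X] Suc]) simp
  show ?case
    unfolding unstopped.simps
    by (simp add: ce_commute[OF Tn_ce U Ue] X_diff aX e_X ce_diff[OF Tn_ce] above_measurable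
        ce_unit[OF Tn_ce])
qed

lemma stopped_X: "stopped K n \<in> X"
  by (induction n) (simp_all add: x_X X_add X_diff X_bp is_bp_unstopped)

lemma unstopped_commute: "u \<in> X \<Longrightarrow> Tn n (unstopped K n u) = unstopped K n (Tn n u)"
  by (rule ce_commute[OF Tn_ce is_bp_unstopped unstopped_measurable])

lemma stopped_adapted: "Tn n (stopped K n) = stopped K n"
proof (induction n)
  case (Suc n)
  have c: "Tn (Suc n) (unstopped K n u) = unstopped K n (Tn (Suc n) u)" if "u \<in> X" for u
    by (rule ce_commute[OF Tn_ce is_bp_unstopped _ that])
      (rule fixed_later[OF X_bp[OF is_bp_unstopped e_X] unstopped_measurable], simp)
  have "Tn (Suc n) (stopped K n) = stopped K n" by (rule fixed_later[OF stopped_X Suc]) simp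
  then show ?case
    by (simp add: ce_add[OF Tn_ce] ce_diff[OF Tn_ce] stopped_X x_X X_diff X_bp is_bp_unstopped c x_step)
qed (simp add: x_step)

lemma stopped_step: "Tn n (stopped K (Suc n)) = stopped K n"
  by (simp add: ce_add[OF Tn_ce] ce_diff[OF Tn_ce] stopped_X x_X X_diff X_bp is_bp_unstopped
      unstopped_commute x_step stopped_adapted unstopped_stopped)

text \<open>The term \<open>rabs (x 0)\<close> covers stopping at time 0, where no jump accounts for
  exceeding \<open>K e\<close>. As \<open>jumps\<close> is a running maximum, the bound persists
  after stopping.\<close>

definition dominator :: "nat \<Rightarrow> nat \<Rightarrow> 'u" where
  "dominator K n = (rabs (x 0) + real K *\<^sub>R e) + jumps n"

lemma jumps_X: "jumps n \<in> X"
  by (induction n) (simp_all add: X_rabs X_diff x_X X_sup)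

lemma jump_le: "x (Suc n) - x n \<le> jumps n"
  using rabs_ge(1)[of "x (Suc n) - x n"] by (cases n) (simp_all add: le_supI2)

lemma jumps_nonneg: "0 \<le> jumps n"
  by (cases n) (simp_all add: rabs_nonneg le_supI2)

lemma K_e_nonneg: "0 \<le> real K *\<^sub>R e"
  using e_nonneg by (simp add: scaleR_nonneg_nonneg)

lemma dominator_mono: "dominator K n \<le> dominator K (Suc n)"
  unfolding dominator_def by simp

lemma dominator_nonneg: "0 \<le> dominator K n"
  unfolding dominator_def by (simp add: rabs_nonneg K_e_nonneg jumps_nonneg)

lemma unstopped_above: "unstopped K n (above K n u) = 0"
  by (cases n) (simp_all add: bp_idem[OF is_bp_above] bp_zero[OF is_bp_unstopped])

text \<open>Before stopping, \<open>x n \<le> K e\<close>, so the stopped martingale exceeds \<open>K e\<close> by at most one jump.\<close>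
lemma stopped_le_dominator: "stopped K n \<le> dominator K n"
proof (induction n)
  case 0
  have "x 0 \<le> rabs (x 0)" by (rule rabs_ge)
  also have "\<dots> \<le> dominator K 0"
    unfolding dominator_def using K_e_nonneg jumps_nonneg[of 0] by simp
  finally show ?case by simp
next
  case (Suc n)
  let ?U = "unstopped K n"
  note U = is_bp_unstopped[of K n]
  have "?U (x n - real K *\<^sub>R e) \<le> 0"
    using pos_event_null[OF U, of "x n - real K *\<^sub>R e"] unstopped_above[of K n]
    unfolding above_def by blast
  then have "?U (x n) \<le> ?U (real K *\<^sub>R e)" by (simp add: bp_diff[OF U])
  moreover have "?U (x (Suc n) - x n) \<le> ?U (jumps n)" by (rule bp_mono[OF U jump_le])
  ultimately have "?U (x n) + ?U (x (Suc n) - x n) \<le> ?U (real K *\<^sub>R e) + ?U (jumps n)"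
    by (rule add_mono)
  then have "?U (x (Suc n)) \<le> ?U (real K *\<^sub>R e + jumps n)"
    by (simp add: bp_diff[OF U] bp_add[OF U])
  also have "\<dots> \<le> ?U (dominator K n)"
    unfolding dominator_def by (rule bp_mono[OF U]) (simp add: rabs_nonneg add.assoc)
  finally have "stopped K (Suc n) \<le> dominator K n - ?U (dominator K n) + ?U (dominator K n)"
    unfolding stopped.simps by (intro add_mono bp_compl_mono[OF U] Suc)
  then show ?case using dominator_mono[of K n] by (simp add: order.trans)
qed

lemma bounded_martingale_stopped:
  "bounded_martingale X e T Tn (stopped K) (dominator K) (T (rabs (x 0) + real K *\<^sub>R e) + w)"
proof unfold_locales
  fix n
  have "T (dominator K n) = T (rabs (x 0) + real K *\<^sub>R e) + T (jumps n)"
    unfolding dominator_def by (rule ce_add[OF T]) (simp_all add: X_add X_rabs x_X X_scaleR e_X jumps_X)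
  then show "T (dominator K n) \<le> T (rabs (x 0) + real K *\<^sub>R e) + w" using T_jumps by simp
  show "dominator K n \<in> X"
    unfolding dominator_def by (simp add: X_add X_rabs x_X X_scaleR e_X jumps_X)
qed (simp_all only: stopped_X stopped_adapted stopped_step dominator_nonneg stopped_le_dominator)

lemma unstopped_never_above: "unstopped K n (u - ever_above K u) = u - ever_above K u"
proof -
  have *: "above K n (u - ever_above K u) = 0" for n u
    unfolding ever_above_def
    using bp_SUP_absorb(2)[of "above K" n u, OF is_bp_above] by (simp add: bp_diff[OF is_bp_above])
  show ?thesis by (induction n) (simp_all add: * del: diff_eq_eq)
qed

lemma stopped_never_above:
  "stopped K n - ever_above K (stopped K n) = x n - ever_above K (x n)"
proof -
  let ?N = "\<lambda>u. u - ever_above K u"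
  note N = is_bp_not_ever_above[of K]
  have "?N (unstopped K n u) = ?N u" for u
    using bp_commute[OF N is_bp_unstopped, of K n u] by (simp only: unstopped_never_above)
  then show ?thesis using unstopped_stopped[of K n] by metis
qed

text \<open>Off \<open>ever_above K\<close> the stopped martingale is \<open>x\<close>.
  \<open>\<Lambda> j\<close> is the event that it falls below \<open>-j e\<close>; off both,
  \<open>x\<close> lies between \<open>- j e\<close> and \<open>K e\<close> and does not oscillate.
  By \<open>bounded_below\<close> the \<open>\<Lambda> j\<close> have void intersection.\<close>

theorem local_convergence:
  "\<exists>\<Lambda>. (\<forall>j::nat. is_bp (\<Lambda> j)) \<and> (\<forall>z\<ge>0. (\<forall>j. z - \<Lambda> j z = 0) \<longrightarrow> z = 0) \<and>
    (\<forall>j. \<exists>v. ord_conv (\<lambda>n. (x n - ever_above K (x n)) - \<Lambda> j (x n - ever_above K (x n))) v)"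
proof -
  interpret B: bounded_martingale X e T Tn "stopped K" "dominator K" "T (rabs (x 0) + real K *\<^sub>R e) + w"
    by (rule bounded_martingale_stopped)
  let ?\<Lambda> = "\<lambda>j::nat. B.ever_lo (- real j)"
  let ?N = "\<lambda>u. u - ever_above K u"
  note N = is_bp_not_ever_above[of K]
  have "\<exists>v. ord_conv (\<lambda>n. ?N (x n) - ?\<Lambda> j (?N (x n))) v" for j
  proof -
    let ?M = "\<lambda>u. u - ?\<Lambda> j u"
    have M: "is_bp ?M" by (rule bp_compl[OF B.is_bp_ever_lo])
    have "no_oscillation (\<lambda>n. ?M (?N (stopped K n)))"
      by (rule no_oscillation_bp[OF no_oscillation_bp[OF B.martingale_no_oscillation N] M])
    then have osc: "no_oscillation (\<lambda>n. ?M (?N (x n)))" by (simp only: stopped_never_above)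
    have le_e: "r *\<^sub>R ?M (?N e) \<le> r *\<^sub>R e" if "0 \<le> r" for r
      using that bp_below[OF bp_comp[OF M N] e_nonneg] by (intro scaleR_left_mono)
    have up: "?M (?N (x n)) \<le> real K *\<^sub>R e" for n
    proof -
      have "?M (?N (x n)) \<le> ?M (real K *\<^sub>R ?N e)" by (rule bp_mono[OF M not_ever_above_le])
      also have "\<dots> = real K *\<^sub>R ?M (?N e)" by (rule bp_scaleR[OF M])
      also have "\<dots> \<le> real K *\<^sub>R e" by (rule le_e) simp
      finally show ?thesis .
    qed
    have dn: "(- real j) *\<^sub>R e \<le> ?M (?N (x n))" for n
    proof -
      have "0 \<le> ?N (?M (stopped K n - (- real j) *\<^sub>R e))"
        by (rule bp_nonneg[OF N]) (rule B.ever_lo_compl)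
      also have "\<dots> = ?M (?N (stopped K n - (- real j) *\<^sub>R e))" by (rule bp_commute[OF N M])
      also have "\<dots> = ?M (?N (stopped K n)) - (- real j) *\<^sub>R ?M (?N e)"
        by (simp only: bp_diff[OF bp_comp[OF M N]] bp_scaleR[OF bp_comp[OF M N]])
      finally have "(- real j) *\<^sub>R ?M (?N e) \<le> ?M (?N (x n))" by (simp only: stopped_never_above diff_ge_0_iff_ge)
      moreover have "(- real j) *\<^sub>R e \<le> (- real j) *\<^sub>R ?M (?N e)" using le_e[of "real j"] by simp
      ultimately show ?thesis by (rule order.trans[rotated])
    qed
    show ?thesis
    proof (rule no_oscillation_ord_conv[OF osc, of "real (K + j)"])
      fix n
      have "real K *\<^sub>R e \<le> real (K + j) *\<^sub>R e" by (intro scaleR_right_mono e_nonneg) simp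
      with up show "?M (?N (x n)) \<le> real (K + j) *\<^sub>R e" by (rule order.trans)
      have "(- real (K + j)) *\<^sub>R e \<le> (- real j) *\<^sub>R e" by (intro scaleR_right_mono e_nonneg) simp
      then show "(- real (K + j)) *\<^sub>R e \<le> ?M (?N (x n))" using dn by (rule order.trans)
    qed
  qed
  then show ?thesis
    using B.is_bp_ever_lo B.bounded_below by (intro exI[of _ ?\<Lambda>]) blast
qed

lemma convergence_band:
  "bp_Sup {P. is_bp P \<and> (\<exists>v. ord_conv (\<lambda>n. P (x n)) v)} = (\<lambda>u. u - blowup u)"
  (is "bp_Sup ?F = ?Q")
proof -
  have Q: "is_bp ?Q" by (rule bp_compl[OF is_bp_blowup])
  have ub: "bp_le P ?Q" if P: "P \<in> ?F" for P
    unfolding bp_le_def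
  proof (intro allI impI)
    fix u :: 'u assume u: "0 \<le> u"
    have Pbp: "is_bp P" using P by blast
    have Pb: "P (blowup u) = 0" using P convergent_null_blowup by blast
    have "0 \<le> ?Q u" by (rule bp_nonneg[OF Q u])
    then have "P (?Q u) \<le> ?Q u" by (rule bp_below[OF Pbp])
    then show "P u \<le> ?Q u" by (simp add: bp_diff[OF Pbp] Pb)
  qed
  have least: "bp_le ?Q R" if R: "is_bp R" and ge: "\<forall>P\<in>?F. bp_le P R" for R
  proof -
    \<comment> \<open>An upper bound \<open>R\<close> contains every local convergence band, so
      \<open>u - R u\<close> vanishes on all of them; by exhaustion nothing of it lies off
      \<open>ever_above K\<close>, for any \<open>K\<close>.\<close>
    have RQ: "u - R u = blowup (u - R u)" if u: "0 \<le> u" for u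
    proof (rule blowup_fixed[symmetric])
      fix K
      let ?N = "\<lambda>u. u - ever_above K u"
      note N = is_bp_not_ever_above[of K]
      have z: "0 \<le> u - R u" using bp_below[OF R u] by simp
      obtain \<Lambda> where L: "\<And>j::nat. is_bp (\<Lambda> j)"
        and L0: "\<And>z. 0 \<le> z \<Longrightarrow> (\<And>j. z - \<Lambda> j z = 0) \<Longrightarrow> z = 0"
        and conv: "\<And>j. \<exists>v. ord_conv (\<lambda>n. ?N (x n) - \<Lambda> j (?N (x n))) v"
        using local_convergence[of K] by blast
      have "?N (u - R u) = 0"
      proof (rule L0)
        show "0 \<le> ?N (u - R u)" by (rule bp_nonneg[OF N z])
        fix j
        let ?M = "\<lambda>u. ?N u - \<Lambda> j (?N u)"
        have M: "is_bp ?M" by (rule bp_comp[OF bp_compl[OF L] N])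
        then have "?M \<in> ?F" using conv by blast
        with ge have "bp_le ?M R" by blast
        then have "?M (u - R u) \<le> R (u - R u)" using z unfolding bp_le_def by blast
        then have "?M (u - R u) \<le> 0" by (simp add: bp_diff[OF R] bp_idem[OF R])
        then show "?M (u - R u) = 0" using bp_nonneg[OF M z] by (rule order.antisym)
      qed
      then show "ever_above K (u - R u) = u - R u" by simp
    qed
    show ?thesis
      unfolding bp_le_def
    proof (intro allI impI)
      fix u :: 'u assume u: "0 \<le> u"
      have "blowup (u - R u) \<le> blowup u"
        by (rule bp_mono[OF is_bp_blowup]) (simp add: bp_nonneg[OF R u])
      with RQ[OF u] have "u - R u \<le> blowup u" by simp
      then show "?Q u \<le> R u" by (simp add: algebra_simps)
    qed
  qed
  show ?thesis
    unfolding bp_Sup_def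
  proof (rule the_equality)
    show "is_bp ?Q \<and> (\<forall>P\<in>?F. bp_le P ?Q) \<and> (\<forall>R. is_bp R \<and> (\<forall>P\<in>?F. bp_le P R) \<longrightarrow> bp_le ?Q R)"
      using Q ub least by blast
    fix Q' :: "'u \<Rightarrow> 'u"
    assume Q': "is_bp Q' \<and> (\<forall>P\<in>?F. bp_le P Q') \<and> (\<forall>R. is_bp R \<and> (\<forall>P\<in>?F. bp_le P R) \<longrightarrow> bp_le Q' R)"
    then have "bp_le Q' ?Q" "bp_le ?Q Q'" using Q ub least by blast+
    then have eq: "Q' u = ?Q u" if "0 \<le> u" for u
      using that unfolding bp_le_def by (meson order.antisym)
    show "Q' = ?Q" by (rule ext, rule is_bp_linearI[OF conjunct1[OF Q'] Q], rule eq)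
  qed
qed

end

section \<open>The infinite part of the supremum\<close>

context unit_ideal
begin

lemma bp_onto_fixed:
  assumes P: "is_bp P"
  shows "bp_onto {b \<in> X. P b = b} = P"
  unfolding bp_onto_def
proof (rule the_equality)
  let ?B = "{b \<in> X. P b = b}"
  have null: "P u = 0" if u: "\<forall>b\<in>?B. disj u b" for u
  proof -
    \<comment> \<open>\<open>P (rabs u)\<close> need not lie in \<open>X\<close>; truncated at
      \<open>e\<close> it becomes an element of the band to test \<open>u\<close> against.\<close>
    let ?b = "inf (P (rabs u)) e"
    have Pu0: "0 \<le> P (rabs u)" by (rule bp_nonneg[OF P rabs_nonneg])
    have b0: "0 \<le> ?b" using Pu0 e_nonneg by (rule le_infI)
    have bX: "?b \<in> X" by (rule X_ideal_pos[OF e_X b0]) simp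
    have "P ?b = ?b"
      by (rule bp_fixed_below[OF P _ b0, of "P (rabs u)"]) (simp_all add: bp_idem[OF P])
    with bX u have "disj u ?b" by blast
    then have "inf (rabs u) ?b = 0" unfolding disj_def rabs_eq[OF b0] .
    moreover have "?b \<le> rabs u" using bp_below[OF P rabs_nonneg] by (rule le_infI1)
    ultimately have "?b = 0" by (simp add: inf_absorb2)
    then have "P (rabs u) = 0" by (rule unit_disjoint[OF Pu0])
    then have "rabs (P u) = 0" by (simp only: bp_rabs[OF P])
    then show ?thesis by (rule rabs_eq_0)
  qed
  then show "is_bp P \<and> (\<forall>b\<in>?B. P b = b) \<and> (\<forall>u. (\<forall>b\<in>?B. disj u b) \<longrightarrow> P u = 0)"
    using P by blast
  fix R :: "'u \<Rightarrow> 'u"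
  assume R: "is_bp R \<and> (\<forall>b\<in>?B. R b = b) \<and> (\<forall>u. (\<forall>b\<in>?B. disj u b) \<longrightarrow> R u = 0)"
  then have Rbp: "is_bp R" by blast
  have "P e \<in> ?B" by (simp add: X_bp[OF P] e_X bp_idem[OF P])
  then have RP: "R (P e) = P e" using R by blast
  have "disj (e - P e) b" if b: "b \<in> ?B" for b
  proof -
    have ge: "0 \<le> e - P e" using bp_below[OF P e_nonneg] by simp
    have "P (rabs b) = rabs b" using b by (simp add: bp_rabs[OF P])
    then have "inf (rabs b) (e - P e) = 0"
      using bp_disjoint[OF P rabs_nonneg ge] by (simp add: bp_diff[OF P] bp_idem[OF P])
    then show ?thesis unfolding disj_def rabs_eq[OF ge] by (simp only: inf.commute)
  qed
  then have "R (e - P e) = 0" using R by blast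
  then have "R e = P e" by (simp add: bp_diff[OF Rbp] RP)
  then show "R = P" by (rule ext[OF bp_eqI[OF Rbp P]])
qed

lemma band_in_fixed:
  assumes P: "is_bp P"
  shows "band_in X {b \<in> X. P b = b}"
  unfolding band_in_def
proof (intro conjI ballI allI impI)
  let ?B = "{b \<in> X. P b = b}"
  show "?B \<subseteq> X" by blast
  show "riesz_subspace ?B"
    unfolding riesz_subspace_def
    by (auto simp: X_zero X_add X_sup X_scaleR bp_zero[OF P] bp_add[OF P] bp_sup[OF P] bp_scaleR[OF P])
  show "y \<in> ?B" if y: "y \<in> X" and b: "b \<in> ?B" and le: "rabs y \<le> rabs b" for y b
  proof -
    have "P (rabs y) = rabs y"
      by (rule bp_fixed_below[OF P _ rabs_nonneg le]) (use b in \<open>simp add: bp_rabs[OF P]\<close>)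
    then have "rabs (y - P y) = 0" by (simp add: bp_rabs[OF bp_compl[OF P], symmetric])
    then have "y - P y = 0" by (rule rabs_eq_0)
    with y show ?thesis by simp
  qed
  show "s \<in> ?B" if D: "D \<subseteq> ?B \<and> is_lub_in X D s" for D s
  proof -
    have sX: "s \<in> X" and ub: "\<And>d. d \<in> D \<Longrightarrow> d \<le> s"
      and lst: "\<And>b. b \<in> X \<Longrightarrow> (\<And>d. d \<in> D \<Longrightarrow> d \<le> b) \<Longrightarrow> s \<le> b"
      using D unfolding is_lub_in_def by auto
    have "s \<le> P s"
    proof (rule lst[OF X_bp[OF P sX]])
      fix d assume d: "d \<in> D"
      have "P d \<le> P s" by (rule bp_mono[OF P ub[OF d]])
      then show "d \<le> P s" using d D by auto
    qed
    moreover have "P s \<le> s"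
    proof (cases "D = {}")
      \<comment> \<open>A supremum of the empty set is a least element of \<open>X\<close>;
        comparison with \<open>s + s\<close> yields \<open>0 \<le> s\<close>.\<close>
      case True
      then have "s \<le> s + s" using lst[OF X_add[OF sX sX]] by blast
      then have "0 \<le> s" by simp
      then show ?thesis by (rule bp_below[OF P])
    next
      case False
      then obtain d where d: "d \<in> D" by blast
      have "d - P d \<le> s - P s" by (rule bp_compl_mono[OF P ub[OF d]])
      then show ?thesis using d D by auto
    qed
    ultimately have "P s = s" by (rule order.antisym[rotated])
    with sX show ?thesis by simp
  qed
qed

lemma sx_eqI:
  assumes "\<And>z y. z \<in> X \<Longrightarrow> y \<in> X \<Longrightarrow> (\<forall>a\<in>A. inf z a \<le> y) \<longleftrightarrow> (\<forall>c\<in>C. inf z c \<le> y)"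
  shows "sx_eq X A C"
proof -
  have lub: "is_lub_in X {inf z a |a. a \<in> D} s \<longleftrightarrow>
      s \<in> X \<and> (\<forall>a\<in>D. inf z a \<le> s) \<and> (\<forall>b\<in>X. (\<forall>a\<in>D. inf z a \<le> b) \<longrightarrow> s \<le> b)" for z s D
    unfolding is_lub_in_def by blast
  show ?thesis
    unfolding sx_eq_def lub by (simp add: assms cong: conj_cong ball_cong)
qed

text \<open>Test the equivalence at \<open>a\<close> itself: the traces of \<open>A\<close> on
  \<open>a\<close> have supremum \<open>a\<close>, those of \<open>below_set X u\<close> stay below
  \<open>inf a u\<close>.\<close>

lemma le_of_sx_eq_below_set:
  assumes u: "0 \<le> u" and eq: "sx_eq X A (below_set X u)" and a: "a \<in> A" "a \<in> X" "0 \<le> a"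
  shows "a \<le> u"
proof -
  have "a \<in> {inf a c |c. c \<in> A}" using a(1) by (auto intro!: exI[of _ a])
  then have "is_lub_in X {inf a c |c. c \<in> A} a"
    unfolding is_lub_in_def using a(2) by auto
  then have "is_lub_in X {inf a c |c. c \<in> below_set X u} a"
    using eq a unfolding sx_eq_def by blast
  moreover have "inf a u \<in> X" by (rule X_ideal_pos[OF a(2)]) (use a u in auto)
  moreover have "inf a c \<le> inf a u" if "c \<in> below_set X u" for c
    using that unfolding below_set_def by (intro inf_mono) simp_all
  ultimately have "a \<le> inf a u" unfolding is_lub_in_def by blast
  then show ?thesis by simp
qed

text \<open>The infinite part of the class of \<open>A\<close> consists of those \<open>b\<close> all of whose multiples lie below \<open>A\<close>;
  this determines the band in the decomposition.\<close>
lemma infinite_band_unique: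
  assumes B: "band_in X B" and u: "0 \<le> u"
    and eq: "sx_eq X A (msum B (below_set X u))"
  shows "B = {b \<in> X. \<forall>n::nat. is_lub_in X {inf (real n *\<^sub>R rabs b) a | a. a \<in> A} (real n *\<^sub>R rabs b)}"
    (is "B = ?C")
proof
  let ?S = "msum B (below_set X u)"
  have BX: "B \<subseteq> X" and Bsub: "riesz_subspace B"
    and solid: "\<And>y b. y \<in> X \<Longrightarrow> b \<in> B \<Longrightarrow> rabs y \<le> rabs b \<Longrightarrow> y \<in> B"
    and Blub: "\<And>D s. D \<subseteq> B \<Longrightarrow> is_lub_in X D s \<Longrightarrow> s \<in> B"
    using B unfolding band_in_def by blast+
  have B0: "0 \<in> B" and Badd: "\<And>a b. a \<in> B \<Longrightarrow> b \<in> B \<Longrightarrow> a + b \<in> B"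
    and Bscale: "\<And>c b. b \<in> B \<Longrightarrow> c *\<^sub>R b \<in> B"
    using Bsub unfolding riesz_subspace_def by blast+
  have Brabs: "rabs b \<in> B" if "b \<in> B" for b
    using solid[of "rabs b" b] that BX X_rabs by (auto simp: rabs_eq rabs_nonneg)
  have eq': "is_lub_in X {inf z a |a. a \<in> A} z \<longleftrightarrow> is_lub_in X {inf z c |c. c \<in> ?S} z" if "z \<in> X" for z
    using eq that unfolding sx_eq_def by blast
  show "B \<subseteq> ?C"
  proof
    fix b assume b: "b \<in> B"
    have "is_lub_in X {inf z a |a. a \<in> A} z" if z: "z \<in> B" for z
    proof -
      have zX: "z \<in> X" using z BX by blast
      have "z + 0 \<in> ?S" unfolding msum_def below_set_def using z X_zero u by blast
      then have "z \<in> {inf z c |c. c \<in> ?S}" by (auto intro!: exI[of _ z])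
      then have "is_lub_in X {inf z c |c. c \<in> ?S} z"
        unfolding is_lub_in_def using zX by auto
      with eq'[OF zX] show ?thesis by blast
    qed
    then have "is_lub_in X {inf (real n *\<^sub>R rabs b) a |a. a \<in> A} (real n *\<^sub>R rabs b)" for n :: nat
      using Bscale[OF Brabs[OF b]] by blast
    with b BX show "b \<in> ?C" by blast
  qed
  show "?C \<subseteq> B"
  proof
    fix b' assume b': "b' \<in> ?C"
    let ?b = "rabs b'"
    have bX: "?b \<in> X" using b' X_rabs by blast
    \<comment> \<open>Its supremum \<open>b1\<close> is the component of \<open>?b\<close> in
      \<open>B\<close>; the remainder \<open>?b2\<close> is disjoint from \<open>B\<close>.\<close>
    let ?D = "{a \<in> B. 0 \<le> a \<and> a \<le> ?b}"
    have "?D \<subseteq> X" "?D \<noteq> {}" "\<exists>c\<in>X. \<forall>a\<in>?D. a \<le> c"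
      using BX B0 bX rabs_nonneg[of b'] by blast+
    then obtain b1 where b1: "is_lub_in X ?D b1"
      using X_complete unfolding dedekind_complete_in_def by meson
    have b1B: "b1 \<in> B" by (rule Blub[OF _ b1]) blast
    have b1ub: "\<And>a. a \<in> ?D \<Longrightarrow> a \<le> b1" and b1le: "b1 \<le> ?b"
      using b1 bX unfolding is_lub_in_def by auto
    have b10: "0 \<le> b1" by (rule b1ub) (use B0 rabs_nonneg in auto)
    let ?b2 = "?b - b1"
    have b20: "0 \<le> ?b2" using b1le by simp
    have b2X: "?b2 \<in> X" using bX b1B BX X_diff by blast
    have b2disj: "inf (rabs a) ?b2 = 0" if a: "a \<in> B" for a
    proof -
      let ?m = "inf (rabs a) ?b2"
      have m0: "0 \<le> ?m" using rabs_nonneg b20 by (rule le_infI)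
      have "?m \<in> X" by (rule X_ideal_pos[OF b2X m0]) simp
      then have "?m \<in> B" by (rule solid[OF _ a]) (simp add: rabs_eq[OF m0])
      then have "b1 + ?m \<in> B" using b1B Badd by blast
      moreover have "b1 + ?m \<le> b1 + ?b2" by (rule add_left_mono) simp
      ultimately have "b1 + ?m \<in> ?D" using add_nonneg_nonneg[OF b10 m0] by simp
      then have "b1 + ?m \<le> b1" by (rule b1ub)
      then show ?thesis using m0 by simp
    qed
    have "?b2 \<le> 0"
    proof (rule archimedean_le_0)
      fix n :: nat
      let ?nb1 = "real n *\<^sub>R b1" and ?nb2 = "real n *\<^sub>R ?b2"
      have n1: "0 \<le> ?nb1" using b10 by (intro scaleR_nonneg_nonneg) simp_all
      have n2: "0 \<le> ?nb2" using b20 by (intro scaleR_nonneg_nonneg) simp_all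
      have ndisj: "inf ?nb2 (rabs a) \<le> 0" if a: "a \<in> B" for a
      proof (cases "n = 0")
        case False
        have "rabs ((1 / real n) *\<^sub>R rabs a) = (1 / real n) *\<^sub>R rabs a"
          by (intro rabs_eq scaleR_nonneg_nonneg rabs_nonneg) simp
        then have "inf ((1 / real n) *\<^sub>R rabs a) ?b2 = 0"
          using b2disj[OF Bscale[OF Brabs[OF a], of "1 / real n"]] by simp
        then have "real n *\<^sub>R inf ((1 / real n) *\<^sub>R rabs a) ?b2 = 0" by simp
        then show ?thesis using False by (simp add: scaleR_inf inf.commute)
      qed simp
      \<comment> \<open>This bounds all \<open>inf (n ?b) s\<close>: elements of \<open>B\<close> do
        not meet \<open>?nb2\<close>, and the part below \<open>u\<close> contributes at most
        \<open>inf ?nb2 u\<close>. So all multiples of \<open>?b2\<close> lie below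
        \<open>u\<close>.\<close>
      let ?y = "?nb1 + inf ?nb2 u"
      have iX: "inf ?nb2 u \<in> X"
        by (rule X_ideal_pos[OF X_scaleR[OF b2X, of "real n"]]) (use n2 u in \<open>auto intro: le_infI\<close>)
      have yX: "?y \<in> X" using iX b1B BX by (intro X_add X_scaleR) auto
      have "is_lub_in X {inf (real n *\<^sub>R ?b) c |c. c \<in> ?S} (real n *\<^sub>R ?b)"
        using b' eq'[OF X_scaleR[OF bX, of "real n"]] by blast
      moreover have "inf (real n *\<^sub>R ?b) s \<le> ?y" if s: "s \<in> ?S" for s
      proof -
        obtain a c where ac: "s = a + c" "a \<in> B" "0 \<le> c" "c \<le> u"
          using s unfolding msum_def below_set_def by blast
        have "inf (real n *\<^sub>R ?b) s = inf (?nb1 + ?nb2) (a + c)"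
          by (simp add: ac(1) scaleR_diff_right)
        also have "\<dots> \<le> ?nb1 + inf ?nb2 (a + c)" by (rule inf_add_pos_le[OF n1])
        also have "inf ?nb2 (a + c) \<le> inf ?nb2 (rabs a + c)"
          by (intro inf_mono order_refl add_right_mono rabs_ge(1))
        also have "\<dots> \<le> inf ?nb2 (rabs a) + inf ?nb2 c"
          by (rule inf_add_le[OF n2 rabs_nonneg ac(3)])
        also have "\<dots> \<le> 0 + inf ?nb2 u"
          by (intro add_mono ndisj ac inf_mono order_refl)
        finally show ?thesis by simp
      qed
      ultimately have "real n *\<^sub>R ?b \<le> ?y" using yX unfolding is_lub_in_def by blast
      moreover have "real n *\<^sub>R ?b = ?nb1 + ?nb2" by (simp add: scaleR_diff_right)
      ultimately have "?nb2 \<le> inf ?nb2 u" by (simp only: add_le_cancel_left)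
      also have "\<dots> \<le> u" by simp
      finally show "?nb2 \<le> u" .
    qed
    then have "?b = b1" using b20 by simp
    then have "?b \<in> B" using b1B by simp
    then show "b' \<in> B" using solid[of b' ?b] b' by (auto simp: rabs_eq rabs_nonneg)
  qed
qed

end

section \<open>Decomposition of sup x along its levels\<close>

context sequence_in
begin

abbreviation posmax :: "nat \<Rightarrow> 'u" where
  "posmax N \<equiv> sup 0 (pmax x N)"

lemma posmax_X: "posmax N \<in> X"
proof -
  have "pmax x N \<in> X" by (induction N) (simp_all add: x_X X_sup)
  then show ?thesis by (simp add: X_sup X_zero)
qed

lemma posmax_ge: "x N \<le> posmax N"
  by (cases N) (simp_all add: le_supI2)

lemma posmax_not_ever_above:
  "posmax N - ever_above K (posmax N) \<le> real K *\<^sub>R (e - ever_above K e)"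
proof -
  note M = is_bp_not_ever_above[of K]
  have "0 \<le> e - ever_above K e" by (rule bp_nonneg[OF M e_nonneg])
  then have 0: "0 \<le> real K *\<^sub>R (e - ever_above K e)" by (intro scaleR_nonneg_nonneg) simp_all
  have "pmax x N - ever_above K (pmax x N) \<le> real K *\<^sub>R (e - ever_above K e)"
  proof (induction N)
    case (Suc N)
    have "pmax x (Suc N) - ever_above K (pmax x (Suc N))
        = sup (pmax x N - ever_above K (pmax x N)) (x (Suc N) - ever_above K (x (Suc N)))"
      unfolding pmax.simps by (rule bp_sup[OF M])
    then show ?case using Suc not_ever_above_le by (simp only: le_sup_iff)
  qed (simp only: pmax.simps not_ever_above_le)
  moreover have "posmax N - ever_above K (posmax N)
      = sup (0 - ever_above K 0) (pmax x N - ever_above K (pmax x N))" by (rule bp_sup[OF M])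
  ultimately show ?thesis using 0 by (simp only: bp_zero[OF is_bp_ever_above] diff_0_right le_sup_iff)
qed

primrec above_all :: "nat \<Rightarrow> 'u \<Rightarrow> 'u" where
  "above_all 0 = (\<lambda>u. u)"
| "above_all (Suc K) = (\<lambda>u. ever_above K (above_all K u))"

text \<open>The event that \<open>K\<close> is the first level that \<open>x\<close> never exceeds; these events are disjoint.\<close>
definition level :: "nat \<Rightarrow> 'u \<Rightarrow> 'u" where
  "level K u = above_all K (u - ever_above K u)"

lemma is_bp_above_all: "is_bp (above_all K)"
proof (induction K)
  case (Suc K)
  show ?case unfolding above_all.simps by (rule bp_comp[OF is_bp_ever_above Suc])
qed (simp add: bp_id)

lemma is_bp_level: "is_bp (level K)"
  unfolding level_def by (rule bp_comp_diff[OF is_bp_above_all is_bp_ever_above])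

lemma ever_above_above_all: "K < L \<Longrightarrow> ever_above K (above_all L u) = above_all L u"
proof (induction L)
  case (Suc L)
  show ?case
  proof (cases "K = L")
    case True
    then show ?thesis by (simp add: bp_idem[OF is_bp_ever_above])
  next
    case False
    then have "ever_above K (above_all L u) = above_all L u" using Suc by simp
    then show ?thesis
      using bp_commute[OF is_bp_ever_above is_bp_ever_above, of K L "above_all L u"] by simp
  qed
qed simp

lemma level_level:
  assumes "K < L"
  shows "level K (level L u) = 0"
  unfolding level_def[of L] unfolding level_def[of K] ever_above_above_all[OF assms]
  by (simp add: bp_zero[OF is_bp_above_all])

text \<open>By induction on \<open>K\<close>: if \<open>z\<close> lies in \<open>above_all K\<close>
  and has no part in \<open>level K\<close>, it lies in \<open>ever_above K\<close>.\<close>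

lemma level_null:
  assumes "\<And>K. level K z = 0"
  shows "blowup z = z"
proof (rule blowup_fixed)
  fix K
  have eq: "ever_above K z = z" if "above_all K z = z" for K
  proof -
    have "above_all K z = above_all K (ever_above K z)"
      using assms[of K] unfolding level_def by (simp add: bp_diff[OF is_bp_above_all])
    also have "\<dots> = ever_above K (above_all K z)" by (rule bp_commute[OF is_bp_above_all is_bp_ever_above])
    finally show ?thesis using that by simp
  qed
  have "above_all K z = z" by (induction K) (simp_all add: eq)
  then show "ever_above K z = z" by (rule eq)
qed

lemma level_disj:
  assumes "K \<noteq> L"
  shows "disj (real K *\<^sub>R level K e) (real L *\<^sub>R level L e)"
proof -
  have nn: "0 \<le> real K *\<^sub>R level K e" for K
    by (intro scaleR_nonneg_nonneg bp_nonneg[OF is_bp_level] e_nonneg) simp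
  have *: "inf (real K *\<^sub>R level K e) (real L *\<^sub>R level L e) = 0" if "K < L" for K L
    by (rule bp_disjoint[OF is_bp_level nn nn, of K])
      (simp_all add: bp_scaleR[OF is_bp_level] bp_idem[OF is_bp_level] level_level[OF that])
  show ?thesis
    unfolding disj_def rabs_eq[OF nn] using *[of K L] *[of L K] assms
    by (metis inf.commute nat_neq_iff)
qed

text \<open>Lateral completeness enters here: the disjoint elements \<open>K level K e\<close> have
  a common bound \<open>m\<close>, and on \<open>level K\<close> the running maxima are at most
  \<open>K e\<close>. The levels and the blow-up band exhaust the space.\<close>

lemma finite_part_bounded:
  assumes "laterally_complete TYPE('u)"
  shows "\<exists>m. \<forall>N. posmax N - blowup (posmax N) \<le> m"
proof -
  let ?D = "range (\<lambda>K::nat. real K *\<^sub>R level K e)"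
  have "(\<forall>d\<in>?D. 0 \<le> d) \<and> (\<forall>a\<in>?D. \<forall>b\<in>?D. a \<noteq> b \<longrightarrow> disj a b)"
  proof (intro conjI ballI impI)
    show "0 \<le> d" if "d \<in> ?D" for d
      using that bp_nonneg[OF is_bp_level e_nonneg] by (auto intro: scaleR_nonneg_nonneg)
    show "disj a b" if "a \<in> ?D" "b \<in> ?D" "a \<noteq> b" for a b
      using that level_disj by (metis (no_types, lifting) imageE)
  qed
  from assms[unfolded laterally_complete_def, THEN spec, THEN mp, OF this] have "bdd_above ?D" .
  then obtain m where m: "\<And>K::nat. real K *\<^sub>R level K e \<le> m"
    unfolding bdd_above_def by blast
  have m0: "0 \<le> m" using m[of 0] by simp
  have "posmax N - blowup (posmax N) \<le> m" for N
  proof -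
    let ?f = "posmax N - blowup (posmax N)"
    let ?z = "sup (?f - m) 0"
    have "level K ?z = 0" for K
    proof -
      note V = is_bp_level[of K]
      have "0 \<le> blowup (posmax N)" by (rule bp_nonneg[OF is_bp_blowup]) simp
      then have "?f \<le> posmax N" by simp
      then have "level K ?f \<le> level K (posmax N)" by (rule bp_mono[OF V])
      also have "\<dots> \<le> above_all K (real K *\<^sub>R (e - ever_above K e))"
        unfolding level_def by (rule bp_mono[OF is_bp_above_all posmax_not_ever_above])
      also have "\<dots> = level K (real K *\<^sub>R level K e)"
        by (simp only: bp_scaleR[OF V] bp_scaleR[OF is_bp_above_all] bp_idem[OF V] level_def[symmetric])
      also have "\<dots> \<le> level K m" by (rule bp_mono[OF V m])
      finally have "level K (?f - m) \<le> 0" by (simp only: bp_diff[OF V] diff_le_0_iff_le)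
      then show ?thesis by (simp only: bp_sup[OF V] bp_zero[OF V] sup_absorb2)
    qed
    then have "?z = blowup ?z" by (rule level_null[symmetric])
    also have "\<dots> = sup (blowup (?f - m)) (blowup 0)" by (rule bp_sup[OF is_bp_blowup])
    also have "blowup (?f - m) = - blowup m"
      by (simp add: bp_diff[OF is_bp_blowup] bp_idem[OF is_bp_blowup])
    also have "sup (- blowup m) (blowup 0) = 0"
      using bp_nonneg[OF is_bp_blowup m0] by (simp add: bp_zero[OF is_bp_blowup] sup_absorb2)
    finally have "?f - m \<le> 0" by (metis sup_ge1)
    then show ?thesis by simp
  qed
  then show ?thesis by blast
qed

lemma le_by_truncation:
  assumes "\<And>n::nat. inf z (real n *\<^sub>R e) \<le> y"
  shows "z \<le> y"
proof -
  have "sup z 0 \<le> y + sup (- z) 0"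
  proof (rule is_lub_least[OF unit_lub], simp, clarify)
    fix n :: nat
    have "inf (sup z 0) (real n *\<^sub>R e) = sup (- z) 0 + inf (sup z 0 - sup (- z) 0) (real n *\<^sub>R e - sup (- z) 0)"
      unfolding add_inf by simp
    also have "\<dots> \<le> sup (- z) 0 + inf z (real n *\<^sub>R e)"
      unfolding pos_part_diff by (intro add_left_mono inf_mono) simp_all
    also have "\<dots> \<le> sup (- z) 0 + y" by (intro add_left_mono assms)
    finally show "inf (sup z 0) (real n *\<^sub>R e) \<le> y + sup (- z) 0" by (simp add: add.commute)
  qed
  then have "sup z 0 - sup (- z) 0 \<le> y" by (simp only: diff_le_eq)
  then show ?thesis by (simp only: pos_part_diff)
qed

text \<open>On \<open>above K n\<close>, \<open>K e \<le> x n\<close>, so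
  \<open>inf z (K e) \<le> inf z (posmax n) \<le> y\<close> there. The union over \<open>n\<close>
  contains the blow-up band, and \<open>K\<close> is arbitrary.\<close>

lemma blowup_le:
  assumes "\<And>N. inf z (posmax N) \<le> y"
  shows "blowup z \<le> blowup y"
proof -
  note Q = is_bp_blowup
  have *: "blowup (inf z (real K *\<^sub>R e)) \<le> blowup y" for K
  proof -
    let ?t = "sup (inf z (real K *\<^sub>R e) - y) 0"
    have "above K n ?t = 0" for n
    proof -
      note A = is_bp_above[of K n]
      have "above K n (real K *\<^sub>R e) \<le> above K n (x n)"
        using above_ge[OF bp_id] by (simp only: bp_scaleR[OF A])
      also have "\<dots> \<le> above K n (posmax n)" by (rule bp_mono[OF A posmax_ge])
      finally have "above K n (inf z (real K *\<^sub>R e)) \<le> above K n (inf z (posmax n))"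
        unfolding bp_inf[OF A] by (intro inf_mono order_refl)
      also have "\<dots> \<le> above K n y" by (rule bp_mono[OF A assms])
      finally have "above K n (inf z (real K *\<^sub>R e) - y) \<le> 0"
        by (simp only: bp_diff[OF A] diff_le_0_iff_le)
      then show ?thesis by (simp only: bp_sup[OF A] bp_zero[OF A] sup_absorb2)
    qed
    then have "ever_above K ?t = 0"
      unfolding ever_above_def by (rule bp_SUP_null[of "above K", OF is_bp_above])
    then have "blowup ?t = 0"
      using ever_above_blowup[of K ?t] bp_commute[OF is_bp_ever_above Q, of K ?t]
      by (simp only: bp_zero[OF Q])
    moreover have "blowup (inf z (real K *\<^sub>R e) - y) \<le> blowup ?t" by (rule bp_mono[OF Q]) simp
    ultimately show ?thesis by (simp only: bp_diff[OF Q] diff_le_0_iff_le)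
  qed
  have "z \<le> blowup y + (z - blowup z)"
  proof (rule le_by_truncation)
    fix n
    have "inf z (real n *\<^sub>R e) - blowup (inf z (real n *\<^sub>R e)) \<le> z - blowup z"
      by (rule bp_compl_mono[OF Q]) simp
    from add_mono[OF *[of n] this] show "inf z (real n *\<^sub>R e) \<le> blowup y + (z - blowup z)" by simp
  qed
  then show ?thesis by (simp add: algebra_simps)
qed

text \<open>The finite part \<open>?u\<close> is the supremum of the \<open>posmax N\<close>
  restricted off the blow-up band. Any other band fitting the description equals the same intrinsic
  set, by \<open>infinite_band_unique\<close>.\<close>

theorem infinite_band:
  assumes "laterally_complete TYPE('u)"
  shows "inf_band X (range posmax) = {b \<in> X. blowup b = b}"
proof -
  let ?B = "{b \<in> X. blowup b = b}"
  let ?f = "\<lambda>N. posmax N - blowup (posmax N)"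
  note Q = is_bp_blowup
  have M: "is_bp (\<lambda>u. u - blowup u)" by (rule bp_compl[OF Q])
  obtain m where "\<And>N. ?f N \<le> m" using finite_part_bounded[OF assms] by blast
  then have u: "is_lub (range ?f) (Sup (range ?f))" by (intro is_lub_cSup) auto
  let ?u = "Sup (range ?f)"
  have f0: "0 \<le> ?f N" for N by (rule bp_nonneg[OF M]) simp
  have fu: "?f N \<le> ?u" for N by (rule is_lub_upper[OF u]) blast
  have u0: "0 \<le> ?u" using f0 fu by (rule order.trans)
  have "is_lub (range (\<lambda>N. blowup (?f N))) (blowup ?u)" by (rule bp_lub[OF Q u])
  then have "is_lub (range (\<lambda>N::nat. 0)) (blowup ?u)"
    by (simp only: bp_diff[OF Q] bp_idem[OF Q] diff_self)
  then have Qu: "blowup ?u = 0" by (rule is_lub_unique) (auto intro: is_lubI)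
  have disj: "disj ?u b" if "b \<in> ?B" for b
  proof -
    have "blowup (rabs b) = rabs b" using that by (simp add: bp_rabs[OF Q])
    then have "inf (rabs b) ?u = 0" by (rule bp_disjoint[OF Q rabs_nonneg u0 _ Qu])
    then show ?thesis unfolding disj_def rabs_eq[OF u0] by (simp only: inf.commute)
  qed
  have sx: "sx_eq X (range posmax) (msum ?B (below_set X ?u))"
  proof (rule sx_eqI, rule iffI)
    fix z y assume "\<forall>c\<in>msum ?B (below_set X ?u). inf z c \<le> y"
    moreover have "posmax N \<in> msum ?B (below_set X ?u)" for N
    proof -
      have "blowup (posmax N) \<in> ?B" by (simp add: X_bp[OF Q posmax_X] bp_idem[OF Q])
      moreover have "?f N \<in> below_set X ?u"
        unfolding below_set_def using f0 fu X_bp[OF M posmax_X] by blast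
      moreover have "posmax N = blowup (posmax N) + ?f N" by simp
      ultimately show ?thesis unfolding msum_def by blast
    qed
    ultimately show "\<forall>a\<in>range posmax. inf z a \<le> y" by blast
  next
    fix z y assume "\<forall>a\<in>range posmax. inf z a \<le> y"
    then have le: "inf z (posmax N) \<le> y" for N by blast
    show "\<forall>c\<in>msum ?B (below_set X ?u). inf z c \<le> y"
    proof
      fix s assume "s \<in> msum ?B (below_set X ?u)"
      then obtain b c where s: "s = b + c" "blowup b = b" "0 \<le> c" "c \<le> ?u"
        unfolding msum_def below_set_def by blast
      \<comment> \<open>On the blow-up band already \<open>z\<close> is below \<open>y\<close>, by
        \<open>blowup_le\<close>; off it \<open>s\<close> is below \<open>?u\<close>, and infinite
        distributivity reduces the claim to the \<open>posmax N\<close>.\<close>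
      show "inf z s \<le> y"
      proof (rule bp_split_le[OF Q])
        have "blowup (inf z s) \<le> blowup z" by (rule bp_mono[OF Q]) simp
        also have "\<dots> \<le> blowup y" by (rule blowup_le[OF le])
        finally show "blowup (inf z s) \<le> blowup y" .
        have "s - blowup s = c - blowup c" by (simp add: s bp_add[OF Q])
        also have "\<dots> \<le> c" using bp_nonneg[OF Q s(3)] by simp
        also have "\<dots> \<le> ?u" by (rule s)
        finally have su: "s - blowup s \<le> ?u" .
        have "inf z s - blowup (inf z s) = inf (z - blowup z) (s - blowup s)"
          by (rule bp_inf[OF M])
        also have "\<dots> \<le> inf (z - blowup z) ?u" using su by (intro inf_mono order_refl)
        also have "\<dots> \<le> y - blowup y"
        proof (rule is_lub_least[OF is_lub_inf[OF u]], clarify)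
          fix N
          have "inf (z - blowup z) (?f N) = inf z (posmax N) - blowup (inf z (posmax N))"
            by (rule bp_inf[OF M, symmetric])
          also have "\<dots> \<le> y - blowup y" by (rule bp_compl_mono[OF Q le])
          finally show "inf (z - blowup z) (?f N) \<le> y - blowup y" .
        qed
        finally show "inf z s - blowup (inf z s) \<le> y - blowup y" .
      qed
    qed
  qed
  have ex: "band_in X ?B \<and> (\<exists>u\<ge>0. (\<forall>b\<in>?B. disj u b) \<and> sx_eq X (range posmax) (msum ?B (below_set X u)))"
    using band_in_fixed[OF Q] u0 disj sx by blast
  show ?thesis
    unfolding inf_band_def
  proof (rule the_equality)
    show "band_in X ?B \<and> (\<exists>u\<ge>0. (\<forall>b\<in>?B. disj u b) \<and> sx_eq X (range posmax) (msum ?B (below_set X u)))"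
      by (rule ex)
    fix B
    assume "band_in X B \<and> (\<exists>u\<ge>0. (\<forall>b\<in>B. disj u b) \<and> sx_eq X (range posmax) (msum B (below_set X u)))"
    then show "B = ?B"
      using infinite_band_unique[of B _ "range posmax"]
        infinite_band_unique[OF band_in_fixed[OF Q] u0 sx] by blast
  qed
qed

end

theorem theoremT2:
  fixes X :: "'u::{ordered_real_vector,conditionally_complete_lattice} set"
    and e :: 'u and T :: "'u \<Rightarrow> 'u" and Tn :: "nat \<Rightarrow> 'u \<Rightarrow> 'u" and x :: "nat \<Rightarrow> 'u"
  assumes "laterally_complete TYPE('u)"
    and "riesz_subspace X" and "order_dense X"
    and "dedekind_complete_in X"
    and "weak_order_unit X e"
    and "cond_exp X e T"
    and "filtration X e T Tn"
    and "martingale X Tn x"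
    and "sx_in_Xu X (T ` range (pmax (\<lambda>n. rabs (x (Suc n) - x n))))"
  shows "\<forall>u. u - bp_Sup {P. is_bp P \<and> (\<exists>v. ord_conv (\<lambda>n. P (x n)) v)} u
           = bp_onto (inf_band X (range (\<lambda>N. sup 0 (pmax x N)))) u"
proof -
  interpret filtered X e T Tn
    by unfold_locales (fact assms)+
  have xX: "x n \<in> X" for n
  proof -
    have "x n \<in> Tn n ` X" using assms(8) unfolding martingale_def by (rule conjunct1[THEN spec])
    then show ?thesis by (rule imageE) (simp add: ce_closed[OF Tn_ce])
  qed
  interpret sequence_in X e x
    by unfold_locales (rule xX)
  let ?d = "pmax (\<lambda>n. rabs (x (Suc n) - x n))"
  obtain w where w: "0 \<le> w" "sx_eq X (T ` range ?d) (below_set X w)"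
    using assms(9) unfolding sx_in_Xu_def by blast
  have dX: "?d N \<in> X" for N by (induction N) (simp_all add: X_rabs X_diff xX X_sup)
  have d0: "0 \<le> ?d N" for N by (cases N) (simp_all add: rabs_nonneg le_supI2)
  \<comment> \<open>The hypothesis on the supremum of all jumps enters as a uniform bound in X^u for
    \<open>T\<close> of the finite running maxima.\<close>
  have "T (?d N) \<le> w" for N
    by (rule le_of_sx_eq_below_set[OF w]) (simp_all add: ce_closed[OF T dX] ce_nonneg[OF T dX d0])
  then interpret jump_martingale X e T Tn x w
    by unfold_locales (rule assms(8))
  show ?thesis
    by (simp add: convergence_band infinite_band[OF assms(1)] bp_onto_fixed[OF is_bp_blowup])
qed

end
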